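(* Let $\mathcal{M}$ be a POMDP with state set $S$, let $\mathsf{Bad}\subseteq S$, and let $\mathcal{F}\subseteq B$ be an adequate (finite) foundation, together with a fixed choice of convex-containing neighbourhoods $\mathcal{N}(\vec b)\subseteq\mathcal{F}$ and vertex-weights $\delta_{\vec b}\in \mathit{Dist}(\mathcal{N}(\vec b))$ for all beliefs $\vec b \in B$. Let $\mathit{db}_{\mathcal{F}}(\mathcal{M})$ be the resulting discretised belief MDP. Then for every $\vec b\in\mathcal{F}$, $$ V(\vec b)\;\le\; \sup_{\sigma\in\Sigma^{\mathit{db}_{\mathcal{F}}(\mathcal{M})}} \mathsf{Pr}^{\sigma}_{\mathit{db}_{\mathcal{F}}(\mathcal{M})}\big(\vec b\models \lozenge\,\overline{\mathsf{Bad}}\big), $$ where the right-hand side is the supremum, over all policies $\sigma$ of $\mathit{db}_{\mathcal{F}}(\mathcal{M})$, of the probability to eventually reach a state in $\overline{\mathsf{Bad}}\cap\mathcal{F}$ when starting in $\vec b$.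
   Context: **MDPs and POMDPs.** An MDP is a tuple $M=\langle S,\mathit{Act},\mathbf{P},s_I\rangle$ with state set $S$, initial state $s_I\in S$, finite action set $\mathit{Act}$ and $\mathbf{P}\colon S\times \mathit{Act}\times S\to[0,1]$ with $\sum_{s'}\mathbf{P}(s,\alpha,s')\in\{0,1\}$ for all $s,\alpha$. Action $\alpha$ is enabled in $s$, written $\alpha\in\mathit{Act}(s)$, if $\mathbf{P}(s,\alpha,s')>0$ for some $s'$. A POMDP is $\mathcal{M}=\langle M,Z,O\rangle$ where $M$ is an MDP with finite $S$, $Z$ is a finite set of observations and $O\colon S\to Z$. Standing assumptions: states with the same observation have the same enabled actions, and every state has at least one enabled action. $\mathit{Dist}(A)$ denotes the set of probability distributions on a finite set $A$, and $\mathit{supp}(\mu)$ the support of $\mu$. **Policies and reachability.** A finite path of an MDP is a sequence $s_0\xrightarrow{\alpha_0}s_1\cdots\xrightarrow{\alpha_{n-1}}s_n$ with $\alpha_i\in\mathit{Act}(s_i)$ and $\mathbf{P}(s_i,\alpha_i,s_{i+1})>0$. A policy maps each finite path to a distribution over the actions enabled in its last state (history-dependent and randomised policies are allowed); $\Sigma^{M}$ is the set of all policies of $M$. $\mathsf{Pr}^{\sigma}_{M}(s\models\lozenge T)$ is the probability, in the Markov chain induced by $\sigma$ on $M$ started in $s$, of eventually visiting the set $T$ (being in $T$ initially counts). **Belief MDP.** $B:=\{\vec b\in\mathit{Dist}(S)\mid O(s)=O(s')\text{ for all }s,s'\in\mathit{supp}(\vec b)\}$ is the set of beliefs; $O(\vec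 b)$ is the common observation of the states in $\mathit{supp}(\vec b)$. Let $\mathbf{P}(s,\alpha,z):=\sum_{s'\in S,\,O(s')=z}\mathbf{P}(s,\alpha,s')$ and $\mathbf{P}(\vec b,\alpha,z):=\sum_{s}\vec b(s)\mathbf{P}(s,\alpha,z)$. If $\mathbf{P}(\vec b,\alpha,z)>0$, define the belief $[\![\vec b|\alpha,z]\!]$ by $$[\![\vec b|\alpha,z]\!](s') := \frac{[O(s')=z]\cdot\sum_{s}\vec b(s)\mathbf{P}(s,\alpha,s')}{\mathbf{P}(\vec b,\alpha,z)},$$ where $[\cdot]$ is the Iverson bracket. The belief MDP $\mathit{bel}(\mathcal{M})$ has state set $B$, actions $\mathit{Act}$, initial state $\vec b_I=\{s_I\mapsto1\}$, and transition function $\mathbf{P}^B(\vec b,\alpha,\vec b')=\mathbf{P}(\vec b,\alpha,O(\vec b'))$ if $\mathbf{P}(\vec b,\alpha,O(\vec b'))>0$ and $\vec b'=[\![\vec b|\alpha,O(\vec b')]\!]$, and $0$ otherwise. ($B$ may be uncountable, but from each belief only countably many beliefs are reachable.) Put $\overline{\mathsf{Bad}}:=\{\vec b\in B\mid\sum_{s\in\mathsf{Bad}}\vec b(s)=1\}$ and define the value $$V(\vec b):=\sup_{\sigma\in\Sigma^{\mathit{bel}(\mathcal{M})}}\mathsf{Pr}^{\sigma}_{\mathit{bel}(\mathcal{M})}(\vec b\models\lozenge\overline{\mathsf{Bad}}).$$ **Foundations and neighbourhoods.** A foundation is a finite set $\mathcal{F}\subseteq B$. A neighbourhood of a belief $\vec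 b$ is a set $\mathcal{N}(\vec b)\subseteq\mathcal{F}$; it is convex-containing if there is $\delta_{\vec b}\in\mathit{Dist}(\mathcal{N}(\vec b))$ with $\vec b=\sum_{\vec b'\in\mathcal{N}(\vec b)}\delta_{\vec b}(\vec b')\cdot\vec b'$. $\mathcal{F}$ is adequate if every belief reachable in $\mathit{bel}(\mathcal{M})$ has a convex-containing neighbourhood in $\mathcal{F}$; in defining the discretised belief MDP, $\mathcal{N}$ is fixed arbitrarily such that $\mathcal{N}(\vec b)\subseteq\mathcal{F}$ is convex-containing for every belief $\vec b\in B$, with fixed corresponding weights $\delta_{\vec b}$. **Discretised belief MDP.** $\mathit{db}_{\mathcal{F}}(\mathcal{M})$ is the MDP with state set $\mathcal{F}$, actions $\mathit{Act}$, initial state $\vec b_I=\{s_I\mapsto1\}$, and transition function, for $\vec b,\vec b'\in\mathcal{F}$ and $z:=O(\vec b')$: $\mathbf{P}^{\mathcal{F}}(\vec b,\alpha,\vec b')=\delta_{[\![\vec b|\alpha,z]\!]}(\vec b')\cdot\mathbf{P}(\vec b,\alpha,z)$ if $\mathbf{P}(\vec b,\alpha,z)>0$ and $\vec b'\in\mathcal{N}([\![\vec b|\alpha,z]\!])$, and $0$ otherwise. *)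

theory Defs
  imports "HOL-Probability.Probability"
begin

section \<open>Markov decision processes\<close>

text \<open>
  The state set is an explicit carrier, because belief MDPs and discretised belief MDPs live on
  subsets of a type; values of \<open>tr\<close> outside the carrier are irrelevant.
  Actions and observations are taken from finite types.
\<close>

record ('s, 'a) mdp =
  states :: "'s set"
  init_state :: 's
  tr :: "'s \<Rightarrow> 'a \<Rightarrow> 's \<Rightarrow> real"

text \<open>
  The condition on sums uses \<open>has_sum\<close> and not \<open>infsum\<close>, since the latter is 0 for families that
  are not summable.
\<close>

locale wf_mdp =
  fixes M :: "('s, 'a::finite, 'm) mdp_scheme"
  assumes init_in_states: "init_state M \<in> states M"
    and tr_range: "\<And>s \<alpha> s'. s \<in> states M \<Longrightarrow> s' \<in> states M \<Longrightarrow> tr M s \<alpha> s' \<in> {0..1}"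
    and tr_sum: "\<And>s \<alpha>. s \<in> states M \<Longrightarrow>
      (tr M s \<alpha> has_sum 0) (states M) \<or> (tr M s \<alpha> has_sum 1) (states M)"

definition enabled :: "('s, 'a, 'm) mdp_scheme \<Rightarrow> 's \<Rightarrow> 'a set" where
  "enabled M s = {\<alpha>. \<exists>s'\<in>states M. tr M s \<alpha> s' > 0}"

text \<open>Finite paths grow at the right: \<open>Step \<pi> \<alpha> s\<close> extends \<open>\<pi>\<close> by the action \<open>\<alpha>\<close> and the state \<open>s\<close>.\<close>

datatype ('s, 'a) fpath = Start 's | Step "('s, 'a) fpath" 'a 's

fun first_state :: "('s, 'a) fpath \<Rightarrow> 's" where
  "first_state (Start s) = s"
| "first_state (Step \<pi> \<alpha> s) = first_state \<pi>"

fun last_state :: "('s, 'a) fpath \<Rightarrow> 's" where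
  "last_state (Start s) = s"
| "last_state (Step \<pi> \<alpha> s) = s"

inductive_set fpaths :: "('s, 'a, 'm) mdp_scheme \<Rightarrow> ('s, 'a) fpath set"
  for M :: "('s, 'a, 'm) mdp_scheme" where
  "s \<in> states M \<Longrightarrow> Start s \<in> fpaths M"
| "\<pi> \<in> fpaths M \<Longrightarrow> \<alpha> \<in> enabled M (last_state \<pi>) \<Longrightarrow> s \<in> states M \<Longrightarrow>
    tr M (last_state \<pi>) \<alpha> s > 0 \<Longrightarrow> Step \<pi> \<alpha> s \<in> fpaths M"

definition reachable :: "('s, 'a, 'm) mdp_scheme \<Rightarrow> 's set" where
  "reachable M = {last_state \<pi> | \<pi>. \<pi> \<in> fpaths M \<and> first_state \<pi> = init_state M}"

definition policies :: "('s, 'a, 'm) mdp_scheme \<Rightarrow> (('s, 'a) fpath \<Rightarrow> 'a pmf) set" where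
  "policies M = {\<sigma>. \<forall>\<pi>\<in>fpaths M. set_pmf (\<sigma> \<pi>) \<subseteq> enabled M (last_state \<pi>)}"


section \<open>Induced Markov chains and reachability probabilities\<close>

text \<open>
  The law of the trajectory of the Markov chain with transition kernel \<open>K\<close> started in \<open>x\<close>:
  the infinite-horizon extension given by the Ionescu-Tulcea theorem, on sequences
  with the product sigma-algebra.
\<close>

definition mc_kernel :: "('x \<Rightarrow> 'x pmf) \<Rightarrow> 'x \<Rightarrow> nat \<Rightarrow> (nat \<Rightarrow> 'x) \<Rightarrow> 'x measure" where
  "mc_kernel K x i \<omega> = measure_pmf (case i of 0 \<Rightarrow> return_pmf x | Suc j \<Rightarrow> K (\<omega> j))"

definition mc_measure :: "('x \<Rightarrow> 'x pmf) \<Rightarrow> 'x \<Rightarrow> (nat \<Rightarrow> 'x) measure" where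
  "mc_measure K x =
    projective_family.lim UNIV
      (Ionescu_Tulcea.CI (mc_kernel K x) (\<lambda>_. count_space UNIV)) (\<lambda>_. count_space UNIV)"

lemma Ionescu_Tulcea_mc_kernel: "Ionescu_Tulcea (mc_kernel K x) (\<lambda>_. count_space UNIV)"
proof (rule Ionescu_Tulcea.intro)
  fix i
  show "mc_kernel K x i \<in> measurable (PiM {0..<i} (\<lambda>_. count_space UNIV))
    (subprob_algebra (count_space UNIV))"
  proof (cases i)
    case 0
    then show ?thesis
      by (auto simp: mc_kernel_def[abs_def] measure_pmf_in_subprob_algebra)
  next
    case (Suc j)
    have "(\<lambda>\<omega>. \<omega> j) \<in> measurable (PiM {0..<i} (\<lambda>_. count_space UNIV)) (count_space UNIV)"
      using Suc by (intro measurable_component_singleton) auto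
    moreover have "(\<lambda>y. measure_pmf (K y)) \<in> measurable (count_space UNIV) (subprob_algebra (count_space UNIV))"
      by (auto simp: measure_pmf_in_subprob_algebra)
    ultimately show ?thesis
      using Suc by (simp add: mc_kernel_def[abs_def])
  qed
qed (simp add: mc_kernel_def prob_space_measure_pmf)

text \<open>
  The successor distribution is a genuine distribution with the given weights
  only for enabled actions; policies give probability 0 to all other actions.
\<close>

definition succ_pmf :: "('s, 'a, 'm) mdp_scheme \<Rightarrow> 's \<Rightarrow> 'a \<Rightarrow> 's pmf" where
  "succ_pmf M s \<alpha> = embed_pmf (\<lambda>s'. if s' \<in> states M then tr M s \<alpha> s' else 0)"

text \<open>The states of the Markov chain induced by a policy are the finite paths of the MDP.\<close>

definition induced_kernel ::
  "('s, 'a, 'm) mdp_scheme \<Rightarrow> (('s, 'a) fpath \<Rightarrow> 'a pmf) \<Rightarrow> ('s, 'a) fpath \<Rightarrow> ('s, 'a) fpath pmf" where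
  "induced_kernel M \<sigma> \<pi> =
    bind_pmf (\<sigma> \<pi>) (\<lambda>\<alpha>. map_pmf (Step \<pi> \<alpha>) (succ_pmf M (last_state \<pi>) \<alpha>))"

definition reach_prob ::
  "('s, 'a, 'm) mdp_scheme \<Rightarrow> (('s, 'a) fpath \<Rightarrow> 'a pmf) \<Rightarrow> 's \<Rightarrow> 's set \<Rightarrow> real" where
  "reach_prob M \<sigma> s T =
    measure (mc_measure (induced_kernel M \<sigma>) (Start s)) {\<omega>. \<exists>n. last_state (\<omega> n) \<in> T}"

definition max_reach_prob :: "('s, 'a, 'm) mdp_scheme \<Rightarrow> 's \<Rightarrow> 's set \<Rightarrow> real" where
  "max_reach_prob M s T = (SUP \<sigma>\<in>policies M. reach_prob M \<sigma> s T)"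


section \<open>POMDPs and belief MDPs\<close>

record ('s, 'a, 'z) pomdp = "('s, 'a) mdp" +
  obs :: "'s \<Rightarrow> 'z"

locale wf_pomdp = wf_mdp M for M :: "('s, 'a::finite, 'z::finite) pomdp" +
  assumes finite_states: "finite (states M)"
    and obs_enabled: "\<And>s s'. s \<in> states M \<Longrightarrow> s' \<in> states M \<Longrightarrow> obs M s = obs M s' \<Longrightarrow>
      enabled M s = enabled M s'"
    and enabled_nonempty: "\<And>s. s \<in> states M \<Longrightarrow> enabled M s \<noteq> {}"

definition beliefs :: "('s, 'a, 'z) pomdp \<Rightarrow> 's pmf set" where
  "beliefs M = {b. set_pmf b \<subseteq> states M \<and>
    (\<forall>s\<in>set_pmf b. \<forall>s'\<in>set_pmf b. obs M s = obs M s')}"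

definition belief_obs :: "('s, 'a, 'z) pomdp \<Rightarrow> 's pmf \<Rightarrow> 'z" where
  "belief_obs M b = (THE z. \<forall>s\<in>set_pmf b. obs M s = z)"

definition obs_prob :: "('s, 'a, 'z) pomdp \<Rightarrow> 's \<Rightarrow> 'a \<Rightarrow> 'z \<Rightarrow> real" where
  "obs_prob M s \<alpha> z = (\<Sum>s'\<in>{s'\<in>states M. obs M s' = z}. tr M s \<alpha> s')"

definition belief_obs_prob :: "('s, 'a, 'z) pomdp \<Rightarrow> 's pmf \<Rightarrow> 'a \<Rightarrow> 'z \<Rightarrow> real" where
  "belief_obs_prob M b \<alpha> z = (\<Sum>s\<in>states M. pmf b s * obs_prob M s \<alpha> z)"

text \<open>Only meaningful if \<open>belief_obs_prob M b \<alpha> z > 0\<close>; all uses are guarded accordingly.\<close>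

definition belief_update :: "('s, 'a, 'z) pomdp \<Rightarrow> 's pmf \<Rightarrow> 'a \<Rightarrow> 'z \<Rightarrow> 's pmf" where
  "belief_update M b \<alpha> z = embed_pmf (\<lambda>s'. if s' \<in> states M
     then of_bool (obs M s' = z) * (\<Sum>s\<in>states M. pmf b s * tr M s \<alpha> s') / belief_obs_prob M b \<alpha> z
     else 0)"

definition belief_mdp :: "('s, 'a, 'z) pomdp \<Rightarrow> ('s pmf, 'a) mdp" where
  "belief_mdp M = \<lparr> states = beliefs M,
     init_state = return_pmf (init_state M),
     tr = (\<lambda>b \<alpha> b'. let z = belief_obs M b' in
       if belief_obs_prob M b \<alpha> z > 0 \<and> b' = belief_update M b \<alpha> z
       then belief_obs_prob M b \<alpha> z else 0) \<rparr>"

definition bad_beliefs :: "('s, 'a, 'z) pomdp \<Rightarrow> 's set \<Rightarrow> 's pmf set" where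
  "bad_beliefs M Bad = {b \<in> beliefs M. (\<Sum>s\<in>Bad. pmf b s) = 1}"

definition belief_value :: "('s, 'a, 'z) pomdp \<Rightarrow> 's set \<Rightarrow> 's pmf \<Rightarrow> real" where
  "belief_value M Bad b = max_reach_prob (belief_mdp M) b (bad_beliefs M Bad)"


section \<open>Foundations and discretised belief MDPs\<close>

definition foundation :: "('s, 'a, 'z) pomdp \<Rightarrow> 's pmf set \<Rightarrow> bool" where
  "foundation M F \<longleftrightarrow> finite F \<and> F \<subseteq> beliefs M"

definition vertex_weights :: "'s pmf \<Rightarrow> 's pmf set \<Rightarrow> 's pmf pmf \<Rightarrow> bool" where
  "vertex_weights b N d \<longleftrightarrow>
    set_pmf d \<subseteq> N \<and> (\<forall>s. pmf b s = (\<Sum>b'\<in>N. pmf d b' * pmf b' s))"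

definition convex_containing :: "'s pmf \<Rightarrow> 's pmf set \<Rightarrow> bool" where
  "convex_containing b N \<longleftrightarrow> (\<exists>d. vertex_weights b N d)"

definition adequate :: "('s, 'a, 'z) pomdp \<Rightarrow> 's pmf set \<Rightarrow> bool" where
  "adequate M F \<longleftrightarrow> (\<forall>b\<in>reachable (belief_mdp M). \<exists>N\<subseteq>F. convex_containing b N)"

definition disc_belief_mdp ::
  "('s, 'a, 'z) pomdp \<Rightarrow> 's pmf set \<Rightarrow> ('s pmf \<Rightarrow> 's pmf set) \<Rightarrow> ('s pmf \<Rightarrow> 's pmf pmf) \<Rightarrow>
    ('s pmf, 'a) mdp" where
  "disc_belief_mdp M F N \<delta> = \<lparr> states = F,
     init_state = return_pmf (init_state M),
     tr = (\<lambda>b \<alpha> b'. let z = belief_obs M b' in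
       if belief_obs_prob M b \<alpha> z > 0 \<and> b' \<in> N (belief_update M b \<alpha> z)
       then pmf (\<delta> (belief_update M b \<alpha> z)) b' * belief_obs_prob M b \<alpha> z else 0) \<rparr>"

end

theory Submission
  imports Defs
begin

text \<open>
  Let \<open>V\<^sub>n(b)\<close> be the optimal probability of reaching a bad belief from \<open>b\<close> within \<open>n\<close> steps. By
  induction on \<open>n\<close>, \<open>V\<^sub>n\<close> lies below every convex combination of its values: if \<open>b = \<Sum>\<^sub>i w\<^sub>i v\<^sub>i\<close> then
  \<open>V\<^sub>n(b) \<le> \<Sum>\<^sub>i w\<^sub>i V\<^sub>n(v\<^sub>i)\<close>, because the update of \<open>b\<close> is the combination of the updates of
  the \<open>v\<^sub>i\<close> with weights \<open>w\<^sub>i P(v\<^sub>i,\<alpha>,z) / P(b,\<alpha>,z)\<close>, and because every \<open>v\<^sub>i\<close> is bad whenever \<open>b\<close> is.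
  Hence in the Bellman equation of \<open>V\<^sub>n\<close> each successor belief may be replaced by its vertices at
  the price of an inequality, so that the values \<open>V\<^sub>n\<close> restricted to the foundation are
  attained by a (step-counting) policy of the discretised MDP. On the other hand \<open>sup\<^sub>n V\<^sub>n(b)\<close> bounds the
  reachability probability of every policy of the belief MDP.
\<close>

section \<open>Hitting probabilities of Markov chains\<close>

text \<open>Probability of visiting \<open>T\<close> at one of the times 0, ..., \<open>n\<close>,
  by recursion on the first transition. Values in \<open>ennreal\<close> spare integrability and
  boundedness conditions.\<close>

primrec hit_prob :: "('x \<Rightarrow> 'x pmf) \<Rightarrow> 'x set \<Rightarrow> nat \<Rightarrow> 'x \<Rightarrow> ennreal" where
  "hit_prob K T 0 x = indicator T x"
| "hit_prob K T (Suc n) x = (if x \<in> T then 1 else \<integral>\<^sup>+y. hit_prob K T n y \<partial>K x)"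

lemma pred_coordinate_in_PiM_count_space:
  assumes "i \<in> I"
  shows "Measurable.pred (PiM I (\<lambda>_. count_space UNIV)) (\<lambda>\<omega>. \<omega> i \<in> T)"
  using measurable_compose[OF measurable_component_singleton[OF assms, of "\<lambda>_. count_space UNIV"],
      of "\<lambda>y. y \<in> T"]
  by simp

text \<open>
  The conditional probability \<open>\<Phi> m\<close> of the event, given the first \<open>m + 1\<close> states, is a martingale;
  this reconciles the forward recursion of \<^const>\<open>hit_prob\<close> with the Ionescu-Tulcea construction,
  which extends trajectories at the end.
\<close>

lemma emeasure_mc_measure_hit:
  "emeasure (mc_measure K x) {\<omega>. \<exists>i\<le>n. \<omega> i \<in> T} = hit_prob K T n x"
proof -
  let ?M = "\<lambda>_::nat. count_space UNIV :: 'a measure"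
  interpret IT: Ionescu_Tulcea "mc_kernel K x" ?M
    by (rule Ionescu_Tulcea_mc_kernel)
  let ?\<Omega> = "\<lambda>m. PiM {0..<m} ?M"
  let ?C = "\<lambda>m. IT.C 0 m (\<lambda>_. undefined)"
  define \<Phi> where "\<Phi> m \<omega> = (if \<exists>i\<le>m. \<omega> i \<in> T then 1 else hit_prob K T (n - m) (\<omega> m))" for m and \<omega> :: "nat \<Rightarrow> 'a"
  have start: "(\<lambda>_. undefined) \<in> space (?\<Omega> 0)"
    by (simp add: space_PiM)
  have meas: "\<Phi> m \<in> borel_measurable (?\<Omega> (Suc m))" for m
  proof -
    have [measurable]: "Measurable.pred (?\<Omega> (Suc m)) (\<lambda>\<omega>. \<exists>i\<in>{..m}. \<omega> i \<in> T)"
      by (intro pred_intros_finite pred_coordinate_in_PiM_count_space) auto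
    have [measurable]: "(\<lambda>\<omega>. hit_prob K T (n - m) (\<omega> m)) \<in> borel_measurable (?\<Omega> (Suc m))"
      by (rule measurable_compose[OF measurable_component_singleton[of m]]) auto
    have "(\<lambda>\<omega>. if \<exists>i\<in>{..m}. \<omega> i \<in> T then 1 else hit_prob K T (n - m) (\<omega> m)) \<in> borel_measurable (?\<Omega> (Suc m))"
      by measurable
    also have "(\<lambda>\<omega>. if \<exists>i\<in>{..m}. \<omega> i \<in> T then 1 else hit_prob K T (n - m) (\<omega> m)) = \<Phi> m"
      by (auto simp: fun_eq_iff \<Phi>_def)
    finally show ?thesis .
  qed
  \<comment> \<open>Martingale property: \<open>eP (Suc m)\<close> appends the state at time
    \<open>Suc m\<close> to the states at times 0, ..., \<open>m\<close>.\<close>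
  have ext: "(\<integral>\<^sup>+\<omega>. \<Phi> (Suc m) \<omega> \<partial>IT.eP (Suc m) \<omega>) = \<Phi> m \<omega>"
    if "m < n" and \<omega>: "\<omega> \<in> space (?\<Omega> (Suc m))" for m \<omega>
  proof -
    define k where "k = n - Suc m"
    with \<open>m < n\<close> have k: "n - m = Suc k" "n - Suc m = k"
      by auto
    have "(\<integral>\<^sup>+\<omega>. \<Phi> (Suc m) \<omega> \<partial>IT.eP (Suc m) \<omega>)
        = (\<integral>\<^sup>+y. \<Phi> (Suc m) (fun_upd \<omega> (Suc m) y) \<partial>K (\<omega> m))"
      by (subst IT.nn_integral_eP[OF \<omega> meas]) (simp add: mc_kernel_def)
    also have "\<dots> = \<Phi> m \<omega>"
    proof (cases "\<exists>i\<le>m. \<omega> i \<in> T")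
      case True
      then have "\<Phi> (Suc m) (fun_upd \<omega> (Suc m) y) = 1" for y
        by (auto simp: \<Phi>_def)
      with True show ?thesis
        by (simp add: \<Phi>_def)
    next
      case False
      \<comment> \<open>Without an earlier visit only the appended state \<open>y\<close> can be
        one. Splitting on \<open>k\<close> unfolds \<open>hit_prob\<close>, which is 1 on
        \<open>T\<close> in both cases.\<close>
      have "\<Phi> (Suc m) (fun_upd \<omega> (Suc m) y) = hit_prob K T k y" for y
        using False k by (cases k) (auto simp: \<Phi>_def le_Suc_eq)
      with False k show ?thesis
        by (auto simp: \<Phi>_def)
    qed
    finally show ?thesis .
  qed
  \<comment> \<open>The expectation is constant in \<open>m\<close>; at \<open>m = 0\<close> it is
    computed from the kernel at time 0, the point mass at \<open>x\<close>.\<close>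
  have expect: "(\<integral>\<^sup>+\<omega>. \<Phi> m \<omega> \<partial>?C (Suc m)) = hit_prob K T n x" if "m \<le> n" for m
    using that
  proof (induction m)
    case 0
    have "(\<integral>\<^sup>+\<omega>. \<Phi> 0 \<omega> \<partial>?C (Suc 0)) = (\<integral>\<^sup>+\<omega>. \<Phi> 0 \<omega> \<partial>IT.eP 0 (\<lambda>_. undefined))"
      by (simp only: IT.C.simps add_0 bind_return[OF IT.measurable_eP start])
    also have "\<dots> = (\<integral>\<^sup>+y. \<Phi> 0 (fun_upd (\<lambda>_. undefined) 0 y) \<partial>return_pmf x)"
      by (subst IT.nn_integral_eP[OF start meas]) (simp add: mc_kernel_def)
    also have "\<dots> = hit_prob K T n x"
      by (cases n) (auto simp: \<Phi>_def)
    finally show ?case .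
  next
    case (Suc m)
    have "(\<integral>\<^sup>+\<omega>. \<Phi> (Suc m) \<omega> \<partial>?C (Suc (Suc m)))
        = (\<integral>\<^sup>+\<omega>. \<integral>\<^sup>+\<omega>'. \<Phi> (Suc m) \<omega>' \<partial>IT.eP (Suc m) \<omega> \<partial>?C (Suc m))"
      unfolding IT.C.simps(2)[of 0 "Suc m"] add_0
      by (rule nn_integral_bind[OF meas])
        (simp add: measurable_cong_sets[OF IT.sets_C[OF start] refl] del: IT.C.simps)
    also have "\<dots> = (\<integral>\<^sup>+\<omega>. \<Phi> m \<omega> \<partial>?C (Suc m))"
      using Suc.prems by (intro nn_integral_cong ext) (auto simp: IT.space_C[OF start] simp del: IT.C.simps)
    finally show ?case
      using Suc.IH Suc.prems by (simp del: IT.C.simps)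
  qed
  \<comment> \<open>The event constrains only the times 0, ..., \<open>n\<close>, so its measure in
    the limit is that of \<open>X\<close> under the law of the first \<open>Suc n\<close>
    states.\<close>
  define X where "X = {\<omega> \<in> space (?\<Omega> (Suc n)). \<exists>i\<in>{..n}. \<omega> i \<in> T}"
  have X: "X \<in> sets (?\<Omega> (Suc n))"
    unfolding X_def by (intro pred_intros_finite predE pred_coordinate_in_PiM_count_space) auto
  have "{\<omega>. \<exists>i\<le>n. \<omega> i \<in> T} = prod_emb UNIV ?M {0..<Suc n} X"
    by (auto simp: prod_emb_def X_def space_PiM)
  then have "emeasure (mc_measure K x) {\<omega>. \<exists>i\<le>n. \<omega> i \<in> T} = emeasure (IT.CI {0..<Suc n}) X"
    unfolding mc_measure_def using IT.lim[OF _ X] by simp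
  also have "\<dots> = emeasure (?C (Suc n)) (prod_emb {0..<Suc n} ?M {0..<Suc n} X)"
    by (rule IT.emeasure_CI[OF subset_refl X])
  also have "prod_emb {0..<Suc n} ?M {0..<Suc n} X = X"
    using sets.sets_into_space[OF X] by (rule prod_emb_id[OF _, unfolded space_PiM[symmetric]])
  also have "emeasure (?C (Suc n)) X = (\<integral>\<^sup>+\<omega>. indicator X \<omega> \<partial>?C (Suc n))"
    using X by (simp add: IT.sets_C[OF start] del: IT.C.simps)
  \<comment> \<open>At time \<open>n\<close> no steps remain, so \<open>\<Phi> n\<close> is the
    indicator of \<open>X\<close>.\<close>
  also have "\<dots> = (\<integral>\<^sup>+\<omega>. \<Phi> n \<omega> \<partial>?C (Suc n))"
    by (intro nn_integral_cong)
      (auto simp: IT.space_C[OF start] \<Phi>_def X_def simp del: IT.C.simps split: split_indicator)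
  finally show ?thesis
    by (simp add: expect del: IT.C.simps)
qed

text \<open>The set \<open>UNIV\<close> is hit at time 0 with probability 1, so the total mass is a
  special case of the hitting formula.\<close>

lemma prob_space_mc_measure: "prob_space (mc_measure K x)"
proof
  have "{\<omega>. \<exists>i\<le>0. \<omega> i \<in> UNIV} = (UNIV :: (nat \<Rightarrow> 'a) set)"
    by auto
  then have "emeasure (mc_measure K x) UNIV = 1"
    using emeasure_mc_measure_hit[of K x 0 UNIV] by simp
  moreover interpret IT: Ionescu_Tulcea "mc_kernel K x" "\<lambda>_. count_space UNIV"
    by (rule Ionescu_Tulcea_mc_kernel)
  have "space (mc_measure K x) = UNIV"
    by (simp add: mc_measure_def space_PiM)
  ultimately show "emeasure (mc_measure K x) (space (mc_measure K x)) = 1"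
    by simp
qed

text \<open>Continuity from below along the increasing events of a visit by time
  \<open>n\<close>.\<close>

lemma emeasure_mc_measure_hit_SUP:
  "emeasure (mc_measure K x) {\<omega>. \<exists>i. \<omega> i \<in> T} = (SUP n. hit_prob K T n x)"
proof -
  interpret IT: Ionescu_Tulcea "mc_kernel K x" "\<lambda>_. count_space UNIV"
    by (rule Ionescu_Tulcea_mc_kernel)
  have "{\<omega>. \<exists>i\<in>{..n}. \<omega> i \<in> T} \<in> sets (mc_measure K x)" for n
  proof -
    have "{\<omega> \<in> space (PiM UNIV (\<lambda>_. count_space UNIV)). \<exists>i\<in>{..n}. \<omega> i \<in> T}
        \<in> sets (PiM (UNIV::nat set) (\<lambda>_. count_space UNIV))"
      by (intro pred_intros_finite predE pred_coordinate_in_PiM_count_space) auto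
    then show ?thesis
      by (simp add: mc_measure_def space_PiM)
  qed
  then have "(SUP n. emeasure (mc_measure K x) {\<omega>. \<exists>i\<le>n. \<omega> i \<in> T})
      = emeasure (mc_measure K x) (\<Union>n. {\<omega>. \<exists>i\<le>n. \<omega> i \<in> T})"
    by (intro SUP_emeasure_incseq) (auto simp: incseq_def Bex_def intro: order_trans)
  also have "(\<Union>n. {\<omega>. \<exists>i\<le>n. \<omega> i \<in> T}) = {\<omega>. \<exists>i::nat. \<omega> i \<in> T}"
    by blast
  finally show ?thesis
    by (simp add: emeasure_mc_measure_hit)
qed

section \<open>Bounds on reachability probabilities of MDPs\<close>

text \<open>The induced chain runs on paths, so \<open>T\<close> is lifted to the paths ending in
  it. This reduces reachability to finite horizons.\<close>

lemma reach_prob_eq_SUP: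
  "ennreal (reach_prob M \<sigma> s T)
    = (SUP n. hit_prob (induced_kernel M \<sigma>) {\<pi>. last_state \<pi> \<in> T} n (Start s))"
proof -
  interpret prob_space "mc_measure (induced_kernel M \<sigma>) (Start s)"
    by (rule prob_space_mc_measure)
  show ?thesis
    using emeasure_mc_measure_hit_SUP[of "induced_kernel M \<sigma>" "Start s" "{\<pi>. last_state \<pi> \<in> T}"]
    by (simp add: reach_prob_def emeasure_eq_measure)
qed

lemma reach_prob_le_1: "reach_prob M \<sigma> s T \<le> 1"
  unfolding reach_prob_def by (rule prob_space.prob_le_1[OF prob_space_mc_measure])

lemma reach_prob_le_max_reach_prob:
  "\<sigma> \<in> policies M \<Longrightarrow> reach_prob M \<sigma> s T \<le> max_reach_prob M s T"
  unfolding max_reach_prob_def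
  by (rule cSUP_upper) (auto intro!: bdd_aboveI2 reach_prob_le_1)

lemma nn_integral_induced_kernel:
  "(\<integral>\<^sup>+\<pi>'. f \<pi>' \<partial>induced_kernel M \<sigma> \<pi>)
    = (\<integral>\<^sup>+\<alpha>. \<integral>\<^sup>+s. f (Step \<pi> \<alpha> s) \<partial>succ_pmf M (last_state \<pi>) \<alpha> \<partial>\<sigma> \<pi>)"
  by (simp add: induced_kernel_def)

text \<open>The condition on supports guards against junk in \<^const>\<open>succ_pmf\<close>, whose weights need not sum to 1.\<close>

definition proper_mdp :: "('s, 'a, 'm) mdp_scheme \<Rightarrow> bool" where
  "proper_mdp M \<longleftrightarrow> (\<forall>s\<in>states M. enabled M s \<noteq> {} \<and>
    (\<forall>\<alpha>\<in>enabled M s. set_pmf (succ_pmf M s \<alpha>) \<subseteq> {s' \<in> states M. tr M s \<alpha> s' > 0}))"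

section \<open>Paths and policies of proper MDPs\<close>

lemma last_state_in_states: "\<pi> \<in> fpaths M \<Longrightarrow> last_state \<pi> \<in> states M"
  by (induction rule: fpaths.induct) auto

text \<open>Policies are constrained only on \<open>fpaths M\<close>, so inductions along the
  induced chain must not leave this set.\<close>

lemma proper_mdp_Step:
  assumes "proper_mdp M" "\<pi> \<in> fpaths M" "\<alpha> \<in> enabled M (last_state \<pi>)"
    and "s \<in> set_pmf (succ_pmf M (last_state \<pi>) \<alpha>)"
  shows "Step \<pi> \<alpha> s \<in> fpaths M"
  using assms last_state_in_states[of \<pi> M] unfolding proper_mdp_def
  by (intro fpaths.intros) blast+

text \<open>A choice of enabled actions is a policy. This matters because a supremum of reals over
  an empty family is unspecified.\<close>

lemma policies_nonempty:
  assumes "proper_mdp M"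
  shows "policies M \<noteq> {}"
proof -
  have "(\<lambda>\<pi>. return_pmf (SOME \<alpha>. \<alpha> \<in> enabled M (last_state \<pi>))) \<in> policies M"
    using assms by (auto simp: policies_def proper_mdp_def some_in_eq last_state_in_states)
  then show ?thesis
    by blast
qed

text \<open>Comparison principle: a solution \<open>f\<close> of the Bellman inequalities from above
  dominates every policy, even a history-dependent randomised one, since averaging over actions
  preserves an upper bound. The index of \<open>f\<close> counts the steps left.\<close>

lemma hit_prob_le:
  fixes f :: "nat \<Rightarrow> 's \<Rightarrow> ennreal"
  assumes "proper_mdp M" "\<sigma> \<in> policies M"
    and target: "\<And>n s. s \<in> states M \<Longrightarrow> s \<in> T \<Longrightarrow> 1 \<le> f n s"
    and step: "\<And>n s \<alpha>. s \<in> states M \<Longrightarrow> s \<notin> T \<Longrightarrow> \<alpha> \<in> enabled M s \<Longrightarrow>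
      (\<integral>\<^sup>+s'. f n s' \<partial>succ_pmf M s \<alpha>) \<le> f (Suc n) s"
    and "\<pi> \<in> fpaths M"
  shows "hit_prob (induced_kernel M \<sigma>) {\<pi>. last_state \<pi> \<in> T} n \<pi> \<le> f n (last_state \<pi>)"
  using \<open>\<pi> \<in> fpaths M\<close>
proof (induction n arbitrary: \<pi>)
  case 0
  then show ?case
    using target[OF last_state_in_states, of \<pi> 0] by (auto split: split_indicator)
next
  case (Suc n)
  let ?h = "hit_prob (induced_kernel M \<sigma>) {\<pi>. last_state \<pi> \<in> T} n"
  have s: "last_state \<pi> \<in> states M"
    using Suc.prems by (rule last_state_in_states)
  show ?case
  proof (cases "last_state \<pi> \<in> T")
    case True
    then show ?thesis
      using target[OF s] by simp
  next
    case False
    have en: "\<alpha> \<in> enabled M (last_state \<pi>)" if "\<alpha> \<in> set_pmf (\<sigma> \<pi>)" for \<alpha>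
      using that \<open>\<sigma> \<in> policies M\<close> Suc.prems by (auto simp: policies_def)
    have "(\<integral>\<^sup>+s'. ?h (Step \<pi> \<alpha> s') \<partial>succ_pmf M (last_state \<pi>) \<alpha>) \<le> f (Suc n) (last_state \<pi>)"
      if "\<alpha> \<in> set_pmf (\<sigma> \<pi>)" for \<alpha>
    proof -
      have "(\<integral>\<^sup>+s'. ?h (Step \<pi> \<alpha> s') \<partial>succ_pmf M (last_state \<pi>) \<alpha>)
          \<le> (\<integral>\<^sup>+s'. f n s' \<partial>succ_pmf M (last_state \<pi>) \<alpha>)"
        using Suc.IH[OF proper_mdp_Step[OF \<open>proper_mdp M\<close> Suc.prems en[OF that]]]
        by (intro nn_integral_mono_AE) (simp add: AE_measure_pmf_iff)
      also have "\<dots> \<le> f (Suc n) (last_state \<pi>)"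
        by (rule step[OF s False en[OF that]])
      finally show ?thesis .
    qed
    then have "(\<integral>\<^sup>+\<alpha>. \<integral>\<^sup>+s'. ?h (Step \<pi> \<alpha> s') \<partial>succ_pmf M (last_state \<pi>) \<alpha> \<partial>\<sigma> \<pi>)
        \<le> (\<integral>\<^sup>+\<alpha>. f (Suc n) (last_state \<pi>) \<partial>\<sigma> \<pi>)"
      by (intro nn_integral_mono_AE) (simp add: AE_measure_pmf_iff)
    with False show ?thesis
      by (simp add: nn_integral_induced_kernel)
  qed
qed

lemma reach_prob_le:
  fixes f :: "nat \<Rightarrow> 's \<Rightarrow> ennreal"
  assumes "proper_mdp M" "\<sigma> \<in> policies M" "s \<in> states M"
    and "\<And>n s. s \<in> states M \<Longrightarrow> s \<in> T \<Longrightarrow> 1 \<le> f n s"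
    and "\<And>n s \<alpha>. s \<in> states M \<Longrightarrow> s \<notin> T \<Longrightarrow> \<alpha> \<in> enabled M s \<Longrightarrow>
      (\<integral>\<^sup>+s'. f n s' \<partial>succ_pmf M s \<alpha>) \<le> f (Suc n) s"
  shows "ennreal (reach_prob M \<sigma> s T) \<le> (SUP n. f n s)"
  unfolding reach_prob_eq_SUP
proof (rule SUP_mono')
  fix n
  show "hit_prob (induced_kernel M \<sigma>) {\<pi>. last_state \<pi> \<in> T} n (Start s) \<le> f n s"
    using hit_prob_le[where f = f and T = T, OF assms(1,2,4,5) fpaths.intros(1)[OF assms(3)]] by simp
qed

text \<open>The clock that a step-counting policy reads off its history.\<close>

fun fpath_length :: "('s, 'a) fpath \<Rightarrow> nat" where
  "fpath_length (Start s) = 0"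
| "fpath_length (Step \<pi> \<alpha> s) = Suc (fpath_length \<pi>)"

text \<open>Converse comparison: if some action attains the Bellman inequality in each state outside
  \<open>T\<close>, the policy playing these actions for the fixed horizon \<open>n\<close> reaches
  \<open>T\<close> with probability at least \<open>f n s\<close>.\<close>

lemma ex_policy_reach_prob_ge:
  fixes M :: "('s, 'a, 'm) mdp_scheme" and f :: "nat \<Rightarrow> 's \<Rightarrow> ennreal"
  assumes "proper_mdp M" "s \<in> states M"
    and zero: "\<And>s. s \<in> states M \<Longrightarrow> f 0 s \<le> indicator T s"
    and le_1: "\<And>n s. s \<in> states M \<Longrightarrow> f n s \<le> 1"
    and step: "\<And>n s. s \<in> states M \<Longrightarrow> s \<notin> T \<Longrightarrow> \<exists>\<alpha>\<in>enabled M s.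
      f (Suc n) s \<le> (\<integral>\<^sup>+s'. f n s' \<partial>succ_pmf M s \<alpha>)"
  shows "\<exists>\<sigma>\<in>policies M. f n s \<le> ennreal (reach_prob M \<sigma> s T)"
proof -
  \<comment> \<open>The condition is vacuous off the carrier. In \<open>T\<close> any enabled action
    will do, but one is required since a policy has to act there too.\<close>
  let ?good = "\<lambda>n s \<alpha>. s \<in> states M \<longrightarrow> \<alpha> \<in> enabled M s \<and>
    (s \<notin> T \<longrightarrow> f (Suc n) s \<le> (\<integral>\<^sup>+s'. f n s' \<partial>succ_pmf M s \<alpha>))"
  define act where "act n s = (SOME \<alpha>. ?good n s \<alpha>)" for n s
  have "\<exists>\<alpha>. ?good n s \<alpha>" for n s
  proof (cases "s \<in> states M \<and> s \<notin> T")
    case True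
    then show ?thesis
      using step[of s n] by blast
  next
    case False
    then show ?thesis
      using \<open>proper_mdp M\<close> unfolding proper_mdp_def by blast
  qed
  then have "?good n s (act n s)" for n s
    unfolding act_def by (rule someI_ex)
  then have act: "act n s \<in> enabled M s"
    and act_step: "s \<notin> T \<Longrightarrow> f (Suc n) s \<le> (\<integral>\<^sup>+s'. f n s' \<partial>succ_pmf M s (act n s))"
    if "s \<in> states M" for n s
    using that by blast+
  \<comment> \<open>With \<open>Suc m\<close> steps left, \<open>Suc m\<close> plus the elapsed
    length is \<open>n\<close>, so the index is \<open>m\<close>, the horizon after the move. Beyond
    the horizon the truncated difference is 0, which still yields an enabled action.\<close>
  define \<sigma> where "\<sigma> \<pi> = return_pmf (act (n - Suc (fpath_length \<pi>)) (last_state \<pi>))"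
    for \<pi> :: "('s, 'a) fpath"
  have \<sigma>: "\<sigma> \<in> policies M"
    using act by (simp add: policies_def \<sigma>_def last_state_in_states)
  have "f m (last_state \<pi>) \<le> hit_prob (induced_kernel M \<sigma>) {\<pi>. last_state \<pi> \<in> T} m \<pi>"
    if "\<pi> \<in> fpaths M" "m + fpath_length \<pi> = n" for m \<pi>
    using that
  proof (induction m arbitrary: \<pi>)
    case 0
    then show ?case
      using zero[OF last_state_in_states, of \<pi>] by (simp add: indicator_def)
  next
    case (Suc m)
    let ?h = "hit_prob (induced_kernel M \<sigma>) {\<pi>. last_state \<pi> \<in> T} m"
    let ?\<alpha> = "act m (last_state \<pi>)"
    have s: "last_state \<pi> \<in> states M"
      using Suc.prems by (intro last_state_in_states)
    have \<sigma>_\<pi>: "\<sigma> \<pi> = return_pmf ?\<alpha>"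
      using Suc.prems(2) by (auto simp: \<sigma>_def)
    show ?case
    proof (cases "last_state \<pi> \<in> T")
      case True
      then show ?thesis
        using le_1[OF s] by simp
    next
      case False
      have "f (Suc m) (last_state \<pi>) \<le> (\<integral>\<^sup>+s'. f m s' \<partial>succ_pmf M (last_state \<pi>) ?\<alpha>)"
        by (rule act_step[OF s False])
      also have "\<dots> \<le> (\<integral>\<^sup>+s'. ?h (Step \<pi> ?\<alpha> s') \<partial>succ_pmf M (last_state \<pi>) ?\<alpha>)"
        using Suc.IH[OF proper_mdp_Step[OF \<open>proper_mdp M\<close> Suc.prems(1) act[OF s]]] Suc.prems(2)
        by (intro nn_integral_mono_AE) (simp add: AE_measure_pmf_iff)
      finally show ?thesis
        using False by (simp add: nn_integral_induced_kernel \<sigma>_\<pi>)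
    qed
  qed
  from this[of "Start s" n] have "f n s \<le> ennreal (reach_prob M \<sigma> s T)"
    using \<open>s \<in> states M\<close> unfolding reach_prob_eq_SUP
    by (intro SUP_upper2[of n]) (simp_all add: fpaths.intros)
  with \<sigma> show ?thesis
    by blast
qed

section \<open>Belief updates\<close>

lemma pmf_embed_pmf_finite_support:
  assumes "finite A" "\<And>x. 0 \<le> f x" "\<And>x. x \<notin> A \<Longrightarrow> f x = 0" "sum f A = 1"
  shows "pmf (embed_pmf f) x = f x"
proof (rule pmf_embed_pmf)
  have "(\<integral>\<^sup>+x. ennreal (f x) \<partial>count_space UNIV) = (\<Sum>x\<in>A. ennreal (f x))"
    using assms by (intro nn_integral_count_space'[of A]) auto
  then show "(\<integral>\<^sup>+x. ennreal (f x) \<partial>count_space UNIV) = 1"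
    using assms by (simp add: sum_ennreal)
qed fact

text \<open>The carrier of a belief MDP may be uncountable, so normalisation is stated on a finite
  set \<open>A\<close> that carries all the mass.\<close>

lemma pmf_succ_pmf:
  assumes "finite A" "A \<subseteq> states M"
    and "\<And>s'. s' \<in> states M \<Longrightarrow> 0 \<le> tr M s \<alpha> s'"
    and "\<And>s'. s' \<in> states M \<Longrightarrow> s' \<notin> A \<Longrightarrow> tr M s \<alpha> s' = 0"
    and "(\<Sum>s'\<in>A. tr M s \<alpha> s') = 1"
  shows "pmf (succ_pmf M s \<alpha>) s' = (if s' \<in> states M then tr M s \<alpha> s' else 0)"
  unfolding succ_pmf_def
proof (rule pmf_embed_pmf_finite_support[OF \<open>finite A\<close>])
  show "(\<Sum>s'\<in>A. if s' \<in> states M then tr M s \<alpha> s' else 0) = 1"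
    using assms(2) unfolding assms(5)[symmetric] by (intro sum.cong) auto
qed (use assms in auto)

lemma set_succ_pmf:
  assumes "finite A" "A \<subseteq> states M"
    and "\<And>s'. s' \<in> states M \<Longrightarrow> 0 \<le> tr M s \<alpha> s'"
    and "\<And>s'. s' \<in> states M \<Longrightarrow> s' \<notin> A \<Longrightarrow> tr M s \<alpha> s' = 0"
    and "(\<Sum>s'\<in>A. tr M s \<alpha> s') = 1"
  shows "set_pmf (succ_pmf M s \<alpha>) \<subseteq> {s' \<in> states M. tr M s \<alpha> s' > 0}"
proof
  fix s' assume "s' \<in> set_pmf (succ_pmf M s \<alpha>)"
  then have "0 < pmf (succ_pmf M s \<alpha>) s'"
    by (simp add: pmf_positive)
  then show "s' \<in> {s' \<in> states M. tr M s \<alpha> s' > 0}"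
    by (simp add: pmf_succ_pmf[OF assms] split: if_splits)
qed

lemma nn_integral_succ_pmf:
  assumes "finite A" "A \<subseteq> states M"
    and "\<And>s'. s' \<in> states M \<Longrightarrow> 0 \<le> tr M s \<alpha> s'"
    and "\<And>s'. s' \<in> states M \<Longrightarrow> s' \<notin> A \<Longrightarrow> tr M s \<alpha> s' = 0"
    and "(\<Sum>s'\<in>A. tr M s \<alpha> s') = 1"
    and f: "\<And>s'. s' \<in> A \<Longrightarrow> 0 \<le> f s'"
  shows "(\<integral>\<^sup>+s'. ennreal (f s') \<partial>succ_pmf M s \<alpha>) = ennreal (\<Sum>s'\<in>A. tr M s \<alpha> s' * f s')"
proof -
  \<comment> \<open>Nonnegativity of \<open>f\<close> is known only on \<open>A\<close>. Inserting
    the indicator is harmless because the support lies in \<open>A\<close>.\<close>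
  have "(\<integral>\<^sup>+s'. ennreal (f s') \<partial>succ_pmf M s \<alpha>)
      = (\<integral>\<^sup>+s'. ennreal (f s') * indicator A s' \<partial>succ_pmf M s \<alpha>)"
    using set_succ_pmf[OF assms(1-5)] assms(4)
    by (intro nn_integral_cong_AE) (force simp: AE_measure_pmf_iff split: split_indicator)
  also have "\<dots> = (\<Sum>s'\<in>A. ennreal (f s') * indicator A s' * ennreal (pmf (succ_pmf M s \<alpha>) s'))"
    using \<open>finite A\<close> by (intro nn_integral_measure_pmf_support) auto
  also have "\<dots> = (\<Sum>s'\<in>A. ennreal (tr M s \<alpha> s' * f s'))"
    using assms(2,3) f
    by (intro sum.cong) (auto simp: pmf_succ_pmf[OF assms(1-5)] mult.commute ennreal_mult')
  also have "\<dots> = ennreal (\<Sum>s'\<in>A. tr M s \<alpha> s' * f s')"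
    using assms(2,3) f by (intro sum_ennreal) (auto intro!: mult_nonneg_nonneg)
  finally show ?thesis .
qed

section \<open>Observation probabilities and updates in a finite POMDP\<close>

context wf_pomdp
begin

lemma tr_nonneg: "s \<in> states M \<Longrightarrow> s' \<in> states M \<Longrightarrow> 0 \<le> tr M s \<alpha> s'"
  using tr_range[of s s' \<alpha>] by simp

text \<open>Well-formedness allows the totals 0 and 1; by nonnegativity, a single positive entry
  decides between them.\<close>

lemma sum_tr:
  assumes s: "s \<in> states M"
  shows "(\<Sum>s'\<in>states M. tr M s \<alpha> s') = of_bool (\<alpha> \<in> enabled M s)"
proof (cases "\<alpha> \<in> enabled M s")
  case True
  then obtain s' where "s' \<in> states M" "tr M s \<alpha> s' > 0"
    by (auto simp: enabled_def)
  then have "0 < (\<Sum>s'\<in>states M. tr M s \<alpha> s')"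
    by (intro sum_pos2[OF finite_states]) (auto intro: tr_nonneg[OF s])
  with True show ?thesis
    using tr_sum[OF s, of \<alpha>] by (auto simp: has_sum_finite_iff[OF finite_states])
next
  case False
  then have "tr M s \<alpha> s' = 0" if "s' \<in> states M" for s'
    using that tr_nonneg[OF s that, of \<alpha>] by (force simp: enabled_def not_less)
  with False show ?thesis
    by simp
qed

lemma set_pmf_belief: "b \<in> beliefs M \<Longrightarrow> set_pmf b \<subseteq> states M"
  by (simp add: beliefs_def)

lemma sum_pmf_belief: "b \<in> beliefs M \<Longrightarrow> (\<Sum>s\<in>states M. pmf b s) = 1"
  by (intro sum_pmf_eq_1 finite_states set_pmf_belief)

lemma belief_obs_eq:
  assumes "\<And>s. s \<in> set_pmf b \<Longrightarrow> obs M s = z"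
  shows "belief_obs M b = z"
proof -
  obtain s where s: "s \<in> set_pmf b"
    using set_pmf_not_empty[of b] by blast
  show ?thesis
    unfolding belief_obs_def
  proof (rule the_equality)
    fix z' assume "\<forall>s\<in>set_pmf b. obs M s = z'"
    then show "z' = z"
      using assms[OF s] s by metis
  qed (use assms in blast)
qed

lemma belief_obs_subset:
  assumes "b \<in> beliefs M" "set_pmf b' \<subseteq> set_pmf b"
  shows "belief_obs M b' = belief_obs M b"
proof -
  obtain s where s: "s \<in> set_pmf b"
    using set_pmf_not_empty[of b] by blast
  have obs: "obs M t = obs M s" if "t \<in> set_pmf b" for t
    using assms(1) that s unfolding beliefs_def by blast
  have "belief_obs M b = obs M s"
    by (rule belief_obs_eq[OF obs])
  moreover have "belief_obs M b' = obs M s"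
    using assms(2) by (intro belief_obs_eq obs) blast
  ultimately show ?thesis
    by simp
qed

text \<open>The distribution of the successor state before conditioning on the observation. It is
  linear in \<open>b\<close>, which the normalised update is not; the convexity argument rests on
  this.\<close>

definition unnormalised_update :: "'s pmf \<Rightarrow> 'a \<Rightarrow> 's \<Rightarrow> real" where
  "unnormalised_update b \<alpha> s' = (\<Sum>s\<in>states M. pmf b s * tr M s \<alpha> s')"

lemma unnormalised_update_nonneg: "s' \<in> states M \<Longrightarrow> 0 \<le> unnormalised_update b \<alpha> s'"
  unfolding unnormalised_update_def by (intro sum_nonneg mult_nonneg_nonneg tr_nonneg) auto

lemma belief_obs_prob_eq:
  "belief_obs_prob M b \<alpha> z = (\<Sum>s'\<in>{s'\<in>states M. obs M s' = z}. unnormalised_update b \<alpha> s')"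
  unfolding belief_obs_prob_def obs_prob_def unnormalised_update_def sum_distrib_left
  by (rule sum.swap)

lemma belief_obs_prob_nonneg: "0 \<le> belief_obs_prob M b \<alpha> z"
  unfolding belief_obs_prob_eq by (intro sum_nonneg) (auto intro: unnormalised_update_nonneg)

lemma unnormalised_update_le:
  "s' \<in> states M \<Longrightarrow> unnormalised_update b \<alpha> s' \<le> belief_obs_prob M b \<alpha> (obs M s')"
  unfolding belief_obs_prob_eq using finite_states
  by (intro member_le_sum) (auto intro: unnormalised_update_nonneg)

text \<open>All states in the support share an observation, hence their enabled actions, so any
  \<open>s\<close> in the support can represent \<open>b\<close>.\<close>

lemma sum_belief_obs_prob:
  assumes b: "b \<in> beliefs M" and s: "s \<in> set_pmf b"
  shows "(\<Sum>z\<in>UNIV. belief_obs_prob M b \<alpha> z) = of_bool (\<alpha> \<in> enabled M s)"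
proof -
  have "(\<Sum>z\<in>UNIV. belief_obs_prob M b \<alpha> z) = (\<Sum>s'\<in>states M. unnormalised_update b \<alpha> s')"
    unfolding belief_obs_prob_eq by (rule sum.group) (auto intro: finite_states)
  also have "\<dots> = (\<Sum>t\<in>states M. pmf b t * (\<Sum>s'\<in>states M. tr M t \<alpha> s'))"
    unfolding unnormalised_update_def sum_distrib_left by (rule sum.swap)
  also have "\<dots> = (\<Sum>t\<in>states M. pmf b t * of_bool (\<alpha> \<in> enabled M s))"
  proof (rule sum.cong[OF refl])
    fix t assume t: "t \<in> states M"
    show "pmf b t * (\<Sum>s'\<in>states M. tr M t \<alpha> s') = pmf b t * of_bool (\<alpha> \<in> enabled M s)"
    proof (cases "t \<in> set_pmf b")
      case True
      then have "obs M t = obs M s"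
        using b s unfolding beliefs_def by blast
      then have "enabled M t = enabled M s"
        using set_pmf_belief[OF b] s by (intro obs_enabled[OF t]) blast+
      then show ?thesis
        by (simp add: sum_tr[OF t])
    qed (simp add: set_pmf_iff)
  qed
  also have "\<dots> = of_bool (\<alpha> \<in> enabled M s)"
    using sum_pmf_belief[OF b] by (simp flip: sum_distrib_right)
  finally show ?thesis .
qed

lemma sum_belief_obs_prob_le_1:
  assumes "b \<in> beliefs M"
  shows "(\<Sum>z\<in>UNIV. belief_obs_prob M b \<alpha> z) \<le> 1"
proof -
  obtain s where "s \<in> set_pmf b"
    using set_pmf_not_empty[of b] by blast
  then show ?thesis
    by (simp add: sum_belief_obs_prob[OF assms])
qed

lemma sum_belief_obs_prob_eq_1:
  assumes "b \<in> beliefs M" "belief_obs_prob M b \<alpha> z > 0"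
  shows "(\<Sum>z\<in>UNIV. belief_obs_prob M b \<alpha> z) = 1"
proof -
  obtain s where "s \<in> set_pmf b"
    using set_pmf_not_empty[of b] by blast
  moreover have "0 < (\<Sum>z\<in>UNIV. belief_obs_prob M b \<alpha> z)"
    using assms(2) by (intro sum_pos2[of _ z]) (auto intro: belief_obs_prob_nonneg)
  ultimately show ?thesis
    by (simp add: sum_belief_obs_prob[OF assms(1)] split: if_splits)
qed

lemma ex_belief_obs_prob_pos:
  assumes "b \<in> beliefs M"
  shows "\<exists>\<alpha> z. belief_obs_prob M b \<alpha> z > 0"
proof -
  obtain s where s: "s \<in> set_pmf b"
    using set_pmf_not_empty[of b] by blast
  then obtain \<alpha> where "\<alpha> \<in> enabled M s"
    using enabled_nonempty set_pmf_belief[OF assms] by blast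
  then have "(\<Sum>z\<in>UNIV. belief_obs_prob M b \<alpha> z) \<noteq> 0"
    by (simp add: sum_belief_obs_prob[OF assms s])
  then obtain z where "belief_obs_prob M b \<alpha> z \<noteq> 0"
    by (meson sum.neutral)
  then show ?thesis
    using belief_obs_prob_nonneg[of b \<alpha> z] by (metis order_le_less)
qed

lemma pmf_belief_update:
  assumes "belief_obs_prob M b \<alpha> z > 0"
  shows "pmf (belief_update M b \<alpha> z) s' = (if s' \<in> states M \<and> obs M s' = z
    then unnormalised_update b \<alpha> s' / belief_obs_prob M b \<alpha> z else 0)"
proof -
  let ?f = "\<lambda>s'. if s' \<in> states M
    then of_bool (obs M s' = z) * (\<Sum>s\<in>states M. pmf b s * tr M s \<alpha> s') / belief_obs_prob M b \<alpha> z
    else 0"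
  have f: "?f s' = (if s' \<in> states M \<and> obs M s' = z
    then unnormalised_update b \<alpha> s' / belief_obs_prob M b \<alpha> z else 0)" for s'
    by (simp add: unnormalised_update_def)
  have "pmf (belief_update M b \<alpha> z) s' = ?f s'"
    unfolding belief_update_def
  proof (rule pmf_embed_pmf_finite_support[of "{s'\<in>states M. obs M s' = z}"])
    show "(\<Sum>s'\<in>{s'\<in>states M. obs M s' = z}. ?f s') = 1"
      unfolding f using assms by (simp add: belief_obs_prob_eq flip: sum_divide_distrib)
  next
    show "0 \<le> ?f s'" for s'
      unfolding f using assms by (auto intro!: divide_nonneg_pos unnormalised_update_nonneg)
  qed (auto simp: finite_states)
  then show ?thesis
    by (simp only: f)
qed

text \<open>Clearing the denominator gives a form free of guards: if the normaliser vanishes, so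
  does every unnormalised entry below it, and the junk update is multiplied by 0.\<close>

lemma belief_obs_prob_mult_pmf_belief_update:
  "belief_obs_prob M b \<alpha> z * pmf (belief_update M b \<alpha> z) s' =
    (if s' \<in> states M \<and> obs M s' = z then unnormalised_update b \<alpha> s' else 0)"
proof (cases "belief_obs_prob M b \<alpha> z > 0")
  case True
  then show ?thesis
    by (simp add: pmf_belief_update)
next
  case False
  then have "belief_obs_prob M b \<alpha> z = 0"
    using belief_obs_prob_nonneg[of b \<alpha> z] by simp
  then show ?thesis
    using unnormalised_update_le[of s' b \<alpha>] unnormalised_update_nonneg[of s' b \<alpha>] by auto
qed

lemma set_belief_update:
  assumes "belief_obs_prob M b \<alpha> z > 0"
  shows "set_pmf (belief_update M b \<alpha> z) \<subseteq> {s \<in> states M. obs M s = z}"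
  using assms by (auto simp: set_pmf_iff pmf_belief_update split: if_splits)

lemma belief_update_in_beliefs:
  "belief_obs_prob M b \<alpha> z > 0 \<Longrightarrow> belief_update M b \<alpha> z \<in> beliefs M"
  using set_belief_update[of b \<alpha> z] by (simp add: beliefs_def subset_iff)

lemma belief_obs_belief_update:
  "belief_obs_prob M b \<alpha> z > 0 \<Longrightarrow> belief_obs M (belief_update M b \<alpha> z) = z"
  using set_belief_update[of b \<alpha> z] by (intro belief_obs_eq) auto

end

section \<open>Step-bounded values of beliefs\<close>

text \<open>
  The maximum may range over all actions, since disabled actions contribute 0.
\<close>

primrec step_value :: "('s, 'a::finite, 'z::finite) pomdp \<Rightarrow> 's set \<Rightarrow> nat \<Rightarrow> 's pmf \<Rightarrow> real" where
  "step_value M Bad 0 b = of_bool (b \<in> bad_beliefs M Bad)"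
| "step_value M Bad (Suc n) b = (if b \<in> bad_beliefs M Bad then 1
    else MAX \<alpha>. \<Sum>z\<in>UNIV. belief_obs_prob M b \<alpha> z * step_value M Bad n (belief_update M b \<alpha> z))"

lemma step_value_bad: "b \<in> bad_beliefs M Bad \<Longrightarrow> step_value M Bad n b = 1"
  by (cases n) auto

lemma step_value_ge_action:
  fixes M :: "('s, 'a::finite, 'z::finite) pomdp"
  assumes "b \<notin> bad_beliefs M Bad"
  shows "(\<Sum>z\<in>UNIV. belief_obs_prob M b \<alpha> z * step_value M Bad n (belief_update M b \<alpha> z))
    \<le> step_value M Bad (Suc n) b"
  using assms by (auto intro!: Max_ge)

lemma step_value_attained:
  fixes M :: "('s, 'a::finite, 'z::finite) pomdp"
  assumes "b \<notin> bad_beliefs M Bad"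
  obtains \<alpha> where "step_value M Bad (Suc n) b =
    (\<Sum>z\<in>UNIV. belief_obs_prob M b \<alpha> z * step_value M Bad n (belief_update M b \<alpha> z))"
proof -
  let ?Q = "\<lambda>\<alpha>. \<Sum>z\<in>UNIV. belief_obs_prob M b \<alpha> z * step_value M Bad n (belief_update M b \<alpha> z)"
  have "Max (range ?Q) \<in> range ?Q"
    by (intro Max_in) auto
  then obtain \<alpha> where "Max (range ?Q) = ?Q \<alpha>"
    by blast
  with assms that[of \<alpha>] show ?thesis
    by simp
qed

text \<open>A vertex of positive weight contributes a positive term wherever it has mass. Hence
  vertices inherit both the observation and the badness of \<open>b\<close>.\<close>

lemma set_pmf_convex_combination:
  fixes w :: "'i \<Rightarrow> real"
  assumes "finite I" "\<And>i. i \<in> I \<Longrightarrow> 0 \<le> w i"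
    and "\<And>s. pmf b s = (\<Sum>i\<in>I. w i * pmf (v i) s)" "i \<in> I" "0 < w i"
  shows "set_pmf (v i) \<subseteq> set_pmf b"
proof
  fix s assume "s \<in> set_pmf (v i)"
  then have "0 < (\<Sum>i\<in>I. w i * pmf (v i) s)"
    using assms by (intro sum_pos2[of I i]) (auto simp: pmf_positive)
  then show "s \<in> set_pmf b"
    by (simp add: set_pmf_iff assms(3))
qed

section \<open>Bounds and convexity of step-bounded values\<close>

context wf_pomdp
begin

lemma step_value_bounds:
  assumes "b \<in> beliefs M"
  shows "step_value M Bad n b \<in> {0..1}"
  using assms
proof (induction n arbitrary: b)
  case (Suc n)
  show ?case
  proof (cases "b \<in> bad_beliefs M Bad")
    case False
    then obtain \<alpha> where \<alpha>: "step_value M Bad (Suc n) b =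
        (\<Sum>z\<in>UNIV. belief_obs_prob M b \<alpha> z * step_value M Bad n (belief_update M b \<alpha> z))"
      by (rule step_value_attained)
    \<comment> \<open>An observation of probability 0 may give a junk update outside the beliefs,
      but its product is 0.\<close>
    have "0 \<le> belief_obs_prob M b \<alpha> z * step_value M Bad n (belief_update M b \<alpha> z) \<and>
      belief_obs_prob M b \<alpha> z * step_value M Bad n (belief_update M b \<alpha> z) \<le> belief_obs_prob M b \<alpha> z" for z
    proof (cases "belief_obs_prob M b \<alpha> z > 0")
      case True
      then show ?thesis
        using Suc.IH[OF belief_update_in_beliefs[OF True]] by (simp add: mult_left_le)
    next
      case False
      then have "belief_obs_prob M b \<alpha> z = 0"
        using belief_obs_prob_nonneg[of b \<alpha> z] by simp
      then show ?thesis
        by simp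
    qed
    then have "0 \<le> step_value M Bad (Suc n) b"
      and "step_value M Bad (Suc n) b \<le> (\<Sum>z\<in>UNIV. belief_obs_prob M b \<alpha> z)"
      unfolding \<alpha> by (auto intro!: sum_nonneg sum_mono)
    then show ?thesis
      using sum_belief_obs_prob_le_1[OF Suc.prems, of \<alpha>] by (simp del: step_value.simps)
  qed simp
qed simp

lemma step_value_nonneg: "b \<in> beliefs M \<Longrightarrow> 0 \<le> step_value M Bad n b"
  and step_value_le_1: "b \<in> beliefs M \<Longrightarrow> step_value M Bad n b \<le> 1"
  using step_value_bounds[of b Bad n] by auto

lemma belief_obs_prob_mult_step_value_nonneg:
  "0 \<le> belief_obs_prob M b \<alpha> z * step_value M Bad n (belief_update M b \<alpha> z)"
proof (cases "belief_obs_prob M b \<alpha> z > 0")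
  case True
  then show ?thesis
    using step_value_nonneg[OF belief_update_in_beliefs[OF True]] by simp
next
  case False
  then show ?thesis
    using belief_obs_prob_nonneg[of b \<alpha> z] by simp
qed

lemma belief_obs_prob_mult_step_value_le:
  "belief_obs_prob M b \<alpha> z * step_value M Bad n (belief_update M b \<alpha> z) \<le> belief_obs_prob M b \<alpha> z"
proof (cases "belief_obs_prob M b \<alpha> z > 0")
  case True
  then show ?thesis
    using step_value_le_1[OF belief_update_in_beliefs[OF True]] by simp
next
  case False
  then show ?thesis
    using belief_obs_prob_nonneg[of b \<alpha> z] by simp
qed

text \<open>As a condition on supports, badness passes to every belief with smaller support.\<close>

lemma bad_beliefs_iff:
  assumes "b \<in> beliefs M" "Bad \<subseteq> states M"
  shows "b \<in> bad_beliefs M Bad \<longleftrightarrow> set_pmf b \<subseteq> Bad"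
proof -
  have fin: "finite Bad"
    using assms(2) finite_states by (rule finite_subset)
  have "(\<Sum>s\<in>Bad. pmf b s) = 1 \<longleftrightarrow> set_pmf b \<subseteq> Bad"
    using measure_pmf.prob_eq_1[of Bad b]
    by (auto simp: measure_measure_pmf_finite[OF fin] AE_measure_pmf_iff)
  then show ?thesis
    using assms(1) by (simp add: bad_beliefs_def)
qed

text \<open>All vertices are bad too, so both sides are 1. That the weights sum to 1 is obtained by
  summing the combination over all states.\<close>

lemma step_value_convex_bad:
  assumes "Bad \<subseteq> states M" "b \<in> beliefs M" "finite I"
    and "\<And>i. i \<in> I \<Longrightarrow> 0 < w i" "\<And>i. i \<in> I \<Longrightarrow> v i \<in> beliefs M"
    and "\<And>s. pmf b s = (\<Sum>i\<in>I. w i * pmf (v i) s)"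
    and "b \<in> bad_beliefs M Bad"
  shows "step_value M Bad n b = (\<Sum>i\<in>I. w i * step_value M Bad n (v i))"
proof -
  have "set_pmf (v i) \<subseteq> set_pmf b" if i: "i \<in> I" for i
    using assms(3) less_imp_le[OF assms(4)] assms(6) i assms(4)[OF i]
    by (rule set_pmf_convex_combination)
  then have "v i \<in> bad_beliefs M Bad" if "i \<in> I" for i
    using assms(7) that
    unfolding bad_beliefs_iff[OF assms(2,1)] bad_beliefs_iff[OF assms(5)[OF that] assms(1)]
    by blast
  then have "(\<Sum>i\<in>I. w i * step_value M Bad n (v i)) = (\<Sum>i\<in>I. w i * (\<Sum>s\<in>states M. pmf (v i) s))"
    using assms(5) by (intro sum.cong) (simp_all add: step_value_bad sum_pmf_belief)
  also have "\<dots> = (\<Sum>s\<in>states M. pmf b s)"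
    unfolding sum_distrib_left assms(6) by (rule sum.swap)
  also have "\<dots> = step_value M Bad n b"
    by (simp add: step_value_bad[OF assms(7)] sum_pmf_belief[OF assms(2)])
  finally show ?thesis ..
qed

text \<open>
  Stated for indexed families and not for weights on a set of beliefs, since different \<open>v i\<close> may
  have the same update.
\<close>

lemma step_value_convex:
  assumes "Bad \<subseteq> states M" "b \<in> beliefs M" "finite I"
    and "\<And>i. i \<in> I \<Longrightarrow> 0 < w i" "\<And>i. i \<in> I \<Longrightarrow> v i \<in> beliefs M"
    and "\<And>s. pmf b s = (\<Sum>i\<in>I. w i * pmf (v i) s)"
  shows "step_value M Bad n b \<le> (\<Sum>i\<in>I. w i * step_value M Bad n (v i))"
  using assms(2-)
proof (induction n arbitrary: b I w v)
  case (0 b I w v)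
  show ?case
  proof (cases "b \<in> bad_beliefs M Bad")
    case True
    then show ?thesis
      using step_value_convex_bad[OF assms(1) 0 True, of 0] by simp
  next
    case False
    then show ?thesis
      using 0(3) by (auto intro!: sum_nonneg mult_nonneg_nonneg intro: less_imp_le)
  qed
next
  case (Suc n b I w v)
  show ?case
  proof (cases "b \<in> bad_beliefs M Bad")
    case True
    then show ?thesis
      using step_value_convex_bad[OF assms(1) Suc.prems True, of "Suc n"] by (simp only: order_refl)
  next
    case False
    \<comment> \<open>This action is optimal for \<open>b\<close>. For the vertices it may be
      suboptimal, which only strengthens the inequality.\<close>
    then obtain \<alpha> where \<alpha>: "step_value M Bad (Suc n) b =
        (\<Sum>z\<in>UNIV. belief_obs_prob M b \<alpha> z * step_value M Bad n (belief_update M b \<alpha> z))"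
      by (rule step_value_attained)
    let ?Q = "\<lambda>b z. belief_obs_prob M b \<alpha> z * step_value M Bad n (belief_update M b \<alpha> z)"
    have upd: "unnormalised_update b \<alpha> s' = (\<Sum>i\<in>I. w i * unnormalised_update (v i) \<alpha> s')" for s'
      unfolding unnormalised_update_def Suc.prems(5) sum_distrib_left sum_distrib_right mult.assoc
      by (rule sum.swap)
    have "?Q b z \<le> (\<Sum>i\<in>I. w i * ?Q (v i) z)" for z
    proof (cases "belief_obs_prob M b \<alpha> z > 0")
      case pos: True
      let ?P = "\<lambda>b. belief_obs_prob M b \<alpha> z"
      let ?u = "\<lambda>b. belief_update M b \<alpha> z"
      \<comment> \<open>Only these vertices can produce \<open>z\<close>; the restriction keeps the
        new weights positive and the updates genuine beliefs.\<close>
      define J where "J = {i \<in> I. ?P (v i) > 0}"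
      have J: "finite J" "J \<subseteq> I"
        using Suc.prems(2) by (auto simp: J_def)
      have off_J: "?P (v i) = 0" if "i \<in> I - J" for i
        using that belief_obs_prob_nonneg[of "v i" \<alpha> z] by (simp add: J_def)
      \<comment> \<open>The new weights are the posterior weights of the vertices given
        \<open>z\<close>, by Bayes' rule.\<close>
      have "step_value M Bad n (?u b) \<le> (\<Sum>i\<in>J. w i * ?P (v i) / ?P b * step_value M Bad n (?u (v i)))"
      proof (rule Suc.IH)
        show "?u b \<in> beliefs M"
          using pos by (rule belief_update_in_beliefs)
        show "0 < w i * ?P (v i) / ?P b" if "i \<in> J" for i
          using that pos Suc.prems(3) by (simp add: J_def)
        show "?u (v i) \<in> beliefs M" if "i \<in> J" for i
          using that by (intro belief_update_in_beliefs) (simp add: J_def)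
        fix s
        \<comment> \<open>Multiplying by the normaliser reduces the claim to linearity of the
          unnormalised update.\<close>
        have "?P b * pmf (?u b) s = (\<Sum>i\<in>I. w i * (?P (v i) * pmf (?u (v i)) s))"
          unfolding belief_obs_prob_mult_pmf_belief_update
          by (cases "s \<in> states M \<and> obs M s = z") (auto simp: upd)
        also have "\<dots> = (\<Sum>i\<in>J. w i * (?P (v i) * pmf (?u (v i)) s))"
          using off_J Suc.prems(2) J(2) by (intro sum.mono_neutral_right) auto
        also have "\<dots> = ?P b * (\<Sum>i\<in>J. w i * ?P (v i) / ?P b * pmf (?u (v i)) s)"
          using pos by (simp add: sum_distrib_left mult.assoc)
        finally show "pmf (?u b) s = (\<Sum>i\<in>J. w i * ?P (v i) / ?P b * pmf (?u (v i)) s)"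
          using pos by simp
      qed (fact J(1))
      then have "?Q b z \<le> ?P b * (\<Sum>i\<in>J. w i * ?P (v i) / ?P b * step_value M Bad n (?u (v i)))"
        using pos by (intro mult_left_mono) auto
      also have "\<dots> = (\<Sum>i\<in>J. w i * ?Q (v i) z)"
        using pos by (simp add: sum_distrib_left mult.assoc)
      also have "\<dots> = (\<Sum>i\<in>I. w i * ?Q (v i) z)"
        using off_J Suc.prems(2) J(2) by (intro sum.mono_neutral_left) auto
      finally show ?thesis .
    next
      case False
      then have "?Q b z = 0"
        using belief_obs_prob_nonneg[of b \<alpha> z] by simp
      moreover have "0 \<le> (\<Sum>i\<in>I. w i * ?Q (v i) z)"
        using Suc.prems(3)
        by (intro sum_nonneg mult_nonneg_nonneg belief_obs_prob_mult_step_value_nonneg) (auto intro: less_imp_le)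
      ultimately show ?thesis
        by linarith
    qed
    then have "step_value M Bad (Suc n) b \<le> (\<Sum>z\<in>UNIV. \<Sum>i\<in>I. w i * ?Q (v i) z)"
      unfolding \<alpha> by (rule sum_mono)
    also have "\<dots> = (\<Sum>i\<in>I. w i * (\<Sum>z\<in>UNIV. ?Q (v i) z))"
      unfolding sum_distrib_left by (rule sum.swap)
    also have "\<dots> \<le> (\<Sum>i\<in>I. w i * step_value M Bad (Suc n) (v i))"
    proof (intro sum_mono mult_left_mono)
      fix i assume i: "i \<in> I"
      show "0 \<le> w i"
        using Suc.prems(3)[OF i] by simp
      show "(\<Sum>z\<in>UNIV. ?Q (v i) z) \<le> step_value M Bad (Suc n) (v i)"
      proof (cases "v i \<in> bad_beliefs M Bad")
        \<comment> \<open>At a bad vertex the recursion is cut off at 1, so the sum is compared with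
          the total observation probability instead.\<close>
        case True
        have "(\<Sum>z\<in>UNIV. ?Q (v i) z) \<le> (\<Sum>z\<in>UNIV. belief_obs_prob M (v i) \<alpha> z)"
          by (intro sum_mono belief_obs_prob_mult_step_value_le)
        with True show ?thesis
          using sum_belief_obs_prob_le_1[OF Suc.prems(4)[OF i], of \<alpha>] by simp
      qed (rule step_value_ge_action)
    qed
    finally show ?thesis .
  qed
qed

section \<open>The belief MDP\<close>

lemma belief_mdp_simps:
  "states (belief_mdp M) = beliefs M"
  "tr (belief_mdp M) b \<alpha> b' =
    (if belief_obs_prob M b \<alpha> (belief_obs M b') > 0 \<and> b' = belief_update M b \<alpha> (belief_obs M b')
     then belief_obs_prob M b \<alpha> (belief_obs M b') else 0)"
  by (simp_all add: belief_mdp_def Let_def)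

lemma tr_belief_mdp_update:
  "belief_obs_prob M b \<alpha> z > 0 \<Longrightarrow>
    tr (belief_mdp M) b \<alpha> (belief_update M b \<alpha> z) = belief_obs_prob M b \<alpha> z"
  by (simp add: belief_mdp_simps belief_obs_belief_update)

lemma enabled_belief_mdp: "enabled (belief_mdp M) b = {\<alpha>. \<exists>z. belief_obs_prob M b \<alpha> z > 0}"
proof (intro set_eqI iffI)
  fix \<alpha> assume "\<alpha> \<in> {\<alpha>. \<exists>z. belief_obs_prob M b \<alpha> z > 0}"
  then obtain z where "belief_obs_prob M b \<alpha> z > 0"
    by blast
  then show "\<alpha> \<in> enabled (belief_mdp M) b"
    unfolding enabled_def belief_mdp_simps(1)
    by (auto intro!: bexI[of _ "belief_update M b \<alpha> z"] belief_update_in_beliefs simp: tr_belief_mdp_update)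
qed (auto simp: enabled_def belief_mdp_simps split: if_splits)

text \<open>There is at most one successor per observation. The first five facts are the premises of
  the lemmas on \<open>succ_pmf\<close>; the last turns sums over successors into sums over
  observations.\<close>

lemma succ_belief_mdp:
  fixes b \<alpha>
  defines "A \<equiv> belief_update M b \<alpha> ` {z. belief_obs_prob M b \<alpha> z > 0}"
  assumes b: "b \<in> beliefs M" and \<alpha>: "\<alpha> \<in> enabled (belief_mdp M) b"
  shows "finite A" "A \<subseteq> states (belief_mdp M)"
    and "\<And>b'. b' \<in> states (belief_mdp M) \<Longrightarrow> 0 \<le> tr (belief_mdp M) b \<alpha> b'"
    and "\<And>b'. b' \<in> states (belief_mdp M) \<Longrightarrow> b' \<notin> A \<Longrightarrow> tr (belief_mdp M) b \<alpha> b' = 0"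
    and "(\<Sum>b'\<in>A. tr (belief_mdp M) b \<alpha> b') = 1"
    and "(\<Sum>b'\<in>A. tr (belief_mdp M) b \<alpha> b' * f b')
      = (\<Sum>z\<in>UNIV. belief_obs_prob M b \<alpha> z * f (belief_update M b \<alpha> z))"
proof -
  show "finite A"
    by (simp add: A_def)
  show "A \<subseteq> states (belief_mdp M)"
    by (auto simp: A_def belief_mdp_simps(1) belief_update_in_beliefs)
  show "0 \<le> tr (belief_mdp M) b \<alpha> b'" for b'
    by (simp add: belief_mdp_simps belief_obs_prob_nonneg)
  show "tr (belief_mdp M) b \<alpha> b' = 0" if "b' \<notin> A" for b'
    using that by (auto simp: belief_mdp_simps A_def)
  have sum_A: "(\<Sum>b'\<in>A. tr (belief_mdp M) b \<alpha> b' * f b')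
      = (\<Sum>z\<in>UNIV. belief_obs_prob M b \<alpha> z * f (belief_update M b \<alpha> z))" for f
  proof -
    \<comment> \<open>The updated belief reveals its observation, so different observations give
      different successors.\<close>
    have "inj_on (belief_update M b \<alpha>) {z. belief_obs_prob M b \<alpha> z > 0}"
      by (rule inj_on_inverseI[of _ "belief_obs M"]) (simp add: belief_obs_belief_update)
    then have "(\<Sum>b'\<in>A. tr (belief_mdp M) b \<alpha> b' * f b')
        = (\<Sum>z\<in>{z. belief_obs_prob M b \<alpha> z > 0}. belief_obs_prob M b \<alpha> z * f (belief_update M b \<alpha> z))"
      unfolding A_def by (simp add: sum.reindex tr_belief_mdp_update)
    also have "\<dots> = (\<Sum>z\<in>UNIV. belief_obs_prob M b \<alpha> z * f (belief_update M b \<alpha> z))"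
      using belief_obs_prob_nonneg[of b \<alpha>]
      by (intro sum.mono_neutral_left) (auto simp: order_less_le)
    finally show ?thesis .
  qed
  then show "(\<Sum>b'\<in>A. tr (belief_mdp M) b \<alpha> b' * f b')
      = (\<Sum>z\<in>UNIV. belief_obs_prob M b \<alpha> z * f (belief_update M b \<alpha> z))" .
  obtain z where "belief_obs_prob M b \<alpha> z > 0"
    using \<alpha> by (auto simp: enabled_belief_mdp)
  then show "(\<Sum>b'\<in>A. tr (belief_mdp M) b \<alpha> b') = 1"
    using sum_A[of "\<lambda>_. 1"] sum_belief_obs_prob_eq_1[OF b] by simp
qed

lemma proper_belief_mdp: "proper_mdp (belief_mdp M)"
  unfolding proper_mdp_def
proof (intro ballI conjI)
  fix b assume "b \<in> states (belief_mdp M)"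
  then have b: "b \<in> beliefs M"
    by (simp add: belief_mdp_simps)
  show "enabled (belief_mdp M) b \<noteq> {}"
    using ex_belief_obs_prob_pos[OF b] by (simp add: enabled_belief_mdp)
  fix \<alpha> assume "\<alpha> \<in> enabled (belief_mdp M) b"
  then show "set_pmf (succ_pmf (belief_mdp M) b \<alpha>)
      \<subseteq> {s' \<in> states (belief_mdp M). tr (belief_mdp M) b \<alpha> s' > 0}"
    by (intro set_succ_pmf[OF succ_belief_mdp(1-5)[OF b]])
qed

text \<open>Comparison principle with \<open>f = step_value\<close>: being a maximum over actions,
  it satisfies the upper Bellman inequality for each of them.\<close>

lemma reach_prob_belief_mdp_le:
  assumes \<sigma>: "\<sigma> \<in> policies (belief_mdp M)" and b: "b \<in> beliefs M"
  shows "ennreal (reach_prob (belief_mdp M) \<sigma> b (bad_beliefs M Bad))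
    \<le> (SUP n. ennreal (step_value M Bad n b))"
proof (rule reach_prob_le[OF proper_belief_mdp \<sigma>])
  show "b \<in> states (belief_mdp M)"
    using b by (simp add: belief_mdp_simps)
  show "1 \<le> ennreal (step_value M Bad n b)" if "b \<in> bad_beliefs M Bad" for n b
    using that by (simp add: step_value_bad)
  fix n b \<alpha>
  assume "b \<in> states (belief_mdp M)" and not_bad: "b \<notin> bad_beliefs M Bad"
    and \<alpha>: "\<alpha> \<in> enabled (belief_mdp M) b"
  then have b: "b \<in> beliefs M"
    by (simp add: belief_mdp_simps)
  have "(\<integral>\<^sup>+b'. ennreal (step_value M Bad n b') \<partial>succ_pmf (belief_mdp M) b \<alpha>)
      = ennreal (\<Sum>z\<in>UNIV. belief_obs_prob M b \<alpha> z * step_value M Bad n (belief_update M b \<alpha> z))"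
    by (subst nn_integral_succ_pmf[OF succ_belief_mdp(1-5)[OF b \<alpha>]])
      (auto simp: succ_belief_mdp(6)[OF b \<alpha>] intro!: step_value_nonneg belief_update_in_beliefs)
  also have "\<dots> \<le> ennreal (step_value M Bad (Suc n) b)"
    by (intro ennreal_leI step_value_ge_action not_bad)
  finally show "(\<integral>\<^sup>+b'. ennreal (step_value M Bad n b') \<partial>succ_pmf (belief_mdp M) b \<alpha>)
      \<le> ennreal (step_value M Bad (Suc n) b)" .
qed

end

section \<open>The discretised belief MDP\<close>

locale disc_pomdp = wf_pomdp M for M :: "('s, 'a::finite, 'z::finite) pomdp" +
  fixes F :: "'s pmf set" and N :: "'s pmf \<Rightarrow> 's pmf set" and \<delta> :: "'s pmf \<Rightarrow> 's pmf pmf"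
  assumes F: "foundation M F"
    and N_subset: "\<And>b. b \<in> beliefs M \<Longrightarrow> N b \<subseteq> F"
    and weights: "\<And>b. b \<in> beliefs M \<Longrightarrow> vertex_weights b (N b) (\<delta> b)"
begin

abbreviation "D \<equiv> disc_belief_mdp M F N \<delta>"

lemma finite_F: "finite F" and F_subset_beliefs: "F \<subseteq> beliefs M"
  using F by (auto simp: foundation_def)

lemma set_weights_subset_N: "b \<in> beliefs M \<Longrightarrow> set_pmf (\<delta> b) \<subseteq> N b"
  using weights[of b] by (simp add: vertex_weights_def)

lemma set_weights_subset_F: "b \<in> beliefs M \<Longrightarrow> set_pmf (\<delta> b) \<subseteq> F"
  using set_weights_subset_N N_subset by blast

lemma finite_set_weights: "b \<in> beliefs M \<Longrightarrow> finite (set_pmf (\<delta> b))"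
  by (rule finite_subset[OF set_weights_subset_F finite_F])

text \<open>Restricting to the support of the weights makes them positive, as
  \<open>step_value_convex\<close> requires.\<close>

lemma pmf_eq_weighted_sum:
  assumes b: "b \<in> beliefs M"
  shows "pmf b s = (\<Sum>b'\<in>set_pmf (\<delta> b). pmf (\<delta> b) b' * pmf b' s)"
proof -
  have "pmf b s = (\<Sum>b'\<in>N b. pmf (\<delta> b) b' * pmf b' s)"
    using weights[OF b] by (simp add: vertex_weights_def)
  also have "\<dots> = (\<Sum>b'\<in>set_pmf (\<delta> b). pmf (\<delta> b) b' * pmf b' s)"
    using set_weights_subset_N[OF b] finite_subset[OF N_subset[OF b] finite_F]
    by (intro sum.mono_neutral_right) (auto simp: set_pmf_iff)
  finally show ?thesis .
qed

text \<open>Transitions of \<open>D\<close> read the observation off the vertex, not off the update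
  it replaces; this shows that the two agree.\<close>

lemma belief_obs_vertex:
  assumes b: "b \<in> beliefs M" and b': "b' \<in> set_pmf (\<delta> b)"
  shows "belief_obs M b' = belief_obs M b"
proof (rule belief_obs_subset[OF b])
  show "set_pmf b' \<subseteq> set_pmf b"
    using set_pmf_convex_combination[OF finite_set_weights[OF b] _ pmf_eq_weighted_sum[OF b] b']
      pmf_positive[OF b'] by simp
qed

text \<open>Convexity, padded with zero weights to the index set \<open>F\<close> common to all
  beliefs, so that sums over observations and vertices can be exchanged.\<close>

lemma step_value_le_weighted_sum:
  assumes "Bad \<subseteq> states M" and b: "b \<in> beliefs M"
  shows "step_value M Bad n b \<le> (\<Sum>b'\<in>F. pmf (\<delta> b) b' * step_value M Bad n b')"
proof -
  have "step_value M Bad n b \<le> (\<Sum>b'\<in>set_pmf (\<delta> b). pmf (\<delta> b) b' * step_value M Bad n b')"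
    using set_weights_subset_F[OF b] F_subset_beliefs
    by (intro step_value_convex assms finite_set_weights pmf_eq_weighted_sum pmf_positive) auto
  also have "\<dots> = (\<Sum>b'\<in>F. pmf (\<delta> b) b' * step_value M Bad n b')"
    using set_weights_subset_F[OF b] finite_F
    by (intro sum.mono_neutral_left) (auto simp: set_pmf_iff)
  finally show ?thesis .
qed

section \<open>Transitions of the discretised belief MDP\<close>

lemma states_disc: "states D = F"
  by (simp add: disc_belief_mdp_def)

text \<open>Vertices inherit the observation of the update, so only the summand for the observation
  of \<open>b'\<close> survives, and the guards in the definition are absorbed by zero
  factors.\<close>

lemma tr_disc:
  "tr D b \<alpha> b' = (\<Sum>z\<in>UNIV. belief_obs_prob M b \<alpha> z * pmf (\<delta> (belief_update M b \<alpha> z)) b')"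
proof -
  let ?p = "\<lambda>z. belief_obs_prob M b \<alpha> z * pmf (\<delta> (belief_update M b \<alpha> z)) b'"
  have "?p z = 0" if "z \<noteq> belief_obs M b'" for z
  proof (cases "belief_obs_prob M b \<alpha> z > 0")
    case True
    then have "b' \<notin> set_pmf (\<delta> (belief_update M b \<alpha> z))"
      using belief_obs_vertex[OF belief_update_in_beliefs[OF True]] that
      by (auto simp: belief_obs_belief_update)
    then show ?thesis
      by (simp add: set_pmf_iff)
  next
    case False
    then show ?thesis
      using belief_obs_prob_nonneg[of b \<alpha> z] by simp
  qed
  then have "(\<Sum>z\<in>UNIV. ?p z) = (\<Sum>z\<in>{belief_obs M b'}. ?p z)"
    by (intro sum.mono_neutral_right) auto
  also have "\<dots> = tr D b \<alpha> b'"
  proof (cases "belief_obs_prob M b \<alpha> (belief_obs M b') > 0")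
    case True
    then show ?thesis
      using set_weights_subset_N[OF belief_update_in_beliefs[OF True]]
      by (auto simp: disc_belief_mdp_def Let_def set_pmf_iff)
  next
    case False
    then show ?thesis
      using belief_obs_prob_nonneg[of b \<alpha> "belief_obs M b'"]
      by (simp add: disc_belief_mdp_def Let_def)
  qed
  finally show ?thesis ..
qed

lemma tr_disc_nonneg: "0 \<le> tr D b \<alpha> b'"
  unfolding tr_disc by (intro sum_nonneg mult_nonneg_nonneg belief_obs_prob_nonneg pmf_nonneg)

lemma sum_tr_disc_mult:
  "(\<Sum>b'\<in>F. tr D b \<alpha> b' * f b')
    = (\<Sum>z\<in>UNIV. belief_obs_prob M b \<alpha> z * (\<Sum>b'\<in>F. pmf (\<delta> (belief_update M b \<alpha> z)) b' * f b'))"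
  unfolding tr_disc sum_distrib_left sum_distrib_right mult.assoc by (rule sum.swap)

lemma sum_tr_disc:
  "(\<Sum>b'\<in>F. tr D b \<alpha> b') = (\<Sum>z\<in>UNIV. belief_obs_prob M b \<alpha> z)"
proof -
  have "belief_obs_prob M b \<alpha> z * (\<Sum>b'\<in>F. pmf (\<delta> (belief_update M b \<alpha> z)) b')
      = belief_obs_prob M b \<alpha> z" for z
  proof (cases "belief_obs_prob M b \<alpha> z > 0")
    case True
    then show ?thesis
      using sum_pmf_eq_1[OF finite_F set_weights_subset_F[OF belief_update_in_beliefs[OF True]]]
      by simp
  next
    case False
    then show ?thesis
      using belief_obs_prob_nonneg[of b \<alpha> z] by simp
  qed
  then show ?thesis
    using sum_tr_disc_mult[of b \<alpha> "\<lambda>_. 1"] by (simp only: mult_1_right)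
qed

text \<open>Discretising preserves the total outgoing mass, so if it is positive some belief in
  \<open>F\<close> receives a positive share.\<close>

lemma enabled_disc: "enabled D b = {\<alpha>. \<exists>z. belief_obs_prob M b \<alpha> z > 0}"
proof (intro set_eqI iffI)
  fix \<alpha> assume "\<alpha> \<in> {\<alpha>. \<exists>z. belief_obs_prob M b \<alpha> z > 0}"
  then obtain z where z: "belief_obs_prob M b \<alpha> z > 0"
    by blast
  have "0 < (\<Sum>b'\<in>F. tr D b \<alpha> b')"
    unfolding sum_tr_disc using z by (intro sum_pos2[of _ z]) (auto intro: belief_obs_prob_nonneg)
  then obtain b' where "b' \<in> F" "tr D b \<alpha> b' > 0"
    by (meson not_less sum_nonpos)
  then show "\<alpha> \<in> enabled D b"
    by (auto simp: enabled_def states_disc)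
qed (auto simp: enabled_def disc_belief_mdp_def Let_def split: if_splits)

lemma succ_disc:
  assumes "b \<in> F" "\<alpha> \<in> enabled D b"
  shows "finite F" "F \<subseteq> states D"
    and "\<And>b'. b' \<in> states D \<Longrightarrow> 0 \<le> tr D b \<alpha> b'"
    and "\<And>b'. b' \<in> states D \<Longrightarrow> b' \<notin> F \<Longrightarrow> tr D b \<alpha> b' = 0"
    and "(\<Sum>b'\<in>F. tr D b \<alpha> b') = 1"
  using assms F_subset_beliefs finite_F tr_disc_nonneg sum_belief_obs_prob_eq_1
  by (auto simp: states_disc enabled_disc sum_tr_disc)

lemma proper_disc: "proper_mdp D"
  unfolding proper_mdp_def
proof (intro ballI conjI)
  fix b assume "b \<in> states D"
  then have b: "b \<in> F"
    by (simp add: states_disc)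
  show "enabled D b \<noteq> {}"
    using ex_belief_obs_prob_pos[of b] b F_subset_beliefs by (auto simp: enabled_disc)
  fix \<alpha> assume "\<alpha> \<in> enabled D b"
  then show "set_pmf (succ_pmf D b \<alpha>) \<subseteq> {s' \<in> states D. tr D b \<alpha> s' > 0}"
    by (intro set_succ_pmf[OF succ_disc[OF b]])
qed

text \<open>An optimal action of the belief MDP serves: convexity replaces each updated belief by
  its vertices without decreasing the value.\<close>

lemma ex_action_step_value_le:
  assumes Bad: "Bad \<subseteq> states M" and b: "b \<in> F" and not_bad: "b \<notin> bad_beliefs M Bad"
  shows "\<exists>\<alpha>\<in>enabled D b.
    ennreal (step_value M Bad (Suc n) b) \<le> (\<integral>\<^sup>+b'. ennreal (step_value M Bad n b') \<partial>succ_pmf D b \<alpha>)"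
proof -
  obtain \<alpha> where \<alpha>: "step_value M Bad (Suc n) b =
      (\<Sum>z\<in>UNIV. belief_obs_prob M b \<alpha> z * step_value M Bad n (belief_update M b \<alpha> z))"
    using not_bad by (rule step_value_attained)
  show ?thesis
  proof (cases "\<alpha> \<in> enabled D b")
    case True
    have "step_value M Bad (Suc n) b \<le> (\<Sum>b'\<in>F. tr D b \<alpha> b' * step_value M Bad n b')"
      unfolding \<alpha> sum_tr_disc_mult
    proof (rule sum_mono)
      fix z
      show "belief_obs_prob M b \<alpha> z * step_value M Bad n (belief_update M b \<alpha> z)
        \<le> belief_obs_prob M b \<alpha> z
          * (\<Sum>b'\<in>F. pmf (\<delta> (belief_update M b \<alpha> z)) b' * step_value M Bad n b')"
      proof (cases "belief_obs_prob M b \<alpha> z > 0")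
        case True
        then show ?thesis
          using step_value_le_weighted_sum[OF Bad belief_update_in_beliefs[OF True]] by simp
      next
        case False
        then have "belief_obs_prob M b \<alpha> z = 0"
          using belief_obs_prob_nonneg[of b \<alpha> z] by simp
        then show ?thesis
          by simp
      qed
    qed
    also have "ennreal \<dots> = (\<integral>\<^sup>+b'. ennreal (step_value M Bad n b') \<partial>succ_pmf D b \<alpha>)"
      using F_subset_beliefs
      by (intro nn_integral_succ_pmf[OF succ_disc[OF b True], symmetric] step_value_nonneg) blast+
    finally show ?thesis
      using True by (auto simp: ennreal_leI)
  next
    \<comment> \<open>The maximum ranges over all actions, so the maximiser may be disabled. The
      value is then 0 and any enabled action will do.\<close>
    case False
    then have "belief_obs_prob M b \<alpha> z = 0" for z
      using belief_obs_prob_nonneg[of b \<alpha> z] by (auto simp: enabled_disc order_less_le)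
    then have "step_value M Bad (Suc n) b = 0"
      unfolding \<alpha> by simp
    moreover obtain \<alpha>' where "\<alpha>' \<in> enabled D b"
      using proper_disc b unfolding proper_mdp_def states_disc by blast
    ultimately show ?thesis
      by (intro bexI[of _ \<alpha>']) (simp_all only: ennreal_0 zero_le)
  qed
qed

lemma step_value_le_max_reach_prob:
  assumes Bad: "Bad \<subseteq> states M" and b: "b \<in> F"
  shows "ennreal (step_value M Bad n b) \<le> ennreal (max_reach_prob D b (bad_beliefs M Bad \<inter> F))"
proof -
  have "\<exists>\<sigma>\<in>policies D. ennreal (step_value M Bad n b)
      \<le> ennreal (reach_prob D \<sigma> b (bad_beliefs M Bad \<inter> F))"
  proof (rule ex_policy_reach_prob_ge[OF proper_disc])
    show "b \<in> states D"
      using b by (simp add: states_disc)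
    show "ennreal (step_value M Bad 0 b) \<le> indicator (bad_beliefs M Bad \<inter> F) b" if "b \<in> states D" for b
      using that by (simp add: states_disc)
    show "ennreal (step_value M Bad n b) \<le> 1" if "b \<in> states D" for n b
      using that F_subset_beliefs step_value_le_1[of b Bad n] by (auto simp: states_disc)
    show "\<exists>\<alpha>\<in>enabled D b. ennreal (step_value M Bad (Suc n) b)
        \<le> (\<integral>\<^sup>+b'. ennreal (step_value M Bad n b') \<partial>succ_pmf D b \<alpha>)"
      if "b \<in> states D" "b \<notin> bad_beliefs M Bad \<inter> F" for n b
      using that by (intro ex_action_step_value_le Bad) (auto simp: states_disc)
  qed
  then show ?thesis
    using reach_prob_le_max_reach_prob[of _ D b "bad_beliefs M Bad \<inter> F"]
    by (meson ennreal_leI order_trans)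
qed

text \<open>Since \<open>ennreal\<close> truncates negative reals to 0, this is what allows the
  final inequality to return to the reals.\<close>

lemma max_reach_prob_disc_nonneg: "0 \<le> max_reach_prob D b T"
proof -
  obtain \<sigma> where "\<sigma> \<in> policies D"
    using policies_nonempty[OF proper_disc] by blast
  then have "reach_prob D \<sigma> b T \<le> max_reach_prob D b T"
    by (rule reach_prob_le_max_reach_prob)
  moreover have "0 \<le> reach_prob D \<sigma> b T"
    by (simp add: reach_prob_def)
  ultimately show ?thesis
    by simp
qed

text \<open>The values \<open>step_value\<close> separate the two sides: their supremum bounds every
  policy of the belief MDP, and each of them lies below the supremum for \<open>D\<close>.\<close>

lemma belief_value_le:
  assumes Bad: "Bad \<subseteq> states M" and b: "b \<in> F"
  shows "belief_value M Bad b \<le> max_reach_prob D b (bad_beliefs M Bad \<inter> F)"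
  unfolding belief_value_def max_reach_prob_def[of "belief_mdp M"]
proof (rule cSUP_least[OF policies_nonempty[OF proper_belief_mdp]])
  fix \<sigma> assume "\<sigma> \<in> policies (belief_mdp M)"
  then have "ennreal (reach_prob (belief_mdp M) \<sigma> b (bad_beliefs M Bad))
      \<le> (SUP n. ennreal (step_value M Bad n b))"
    using b F_subset_beliefs by (intro reach_prob_belief_mdp_le) auto
  also have "\<dots> \<le> ennreal (max_reach_prob D b (bad_beliefs M Bad \<inter> F))"
    by (intro SUP_least step_value_le_max_reach_prob assms)
  finally show "reach_prob (belief_mdp M) \<sigma> b (bad_beliefs M Bad)
      \<le> max_reach_prob D b (bad_beliefs M Bad \<inter> F)"
    by (simp add: max_reach_prob_disc_nonneg)
qed

end

theorem theorem3:
  fixes M :: "('s, 'a::finite, 'z::finite) pomdp"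
    and Bad :: "'s set"
    and F :: "'s pmf set"
    and N :: "'s pmf \<Rightarrow> 's pmf set"
    and \<delta> :: "'s pmf \<Rightarrow> 's pmf pmf"
    and b :: "'s pmf"
  assumes "wf_pomdp M"
    and "Bad \<subseteq> states M"
    and "foundation M F"
    and "adequate M F"
    and "\<And>b'. b' \<in> beliefs M \<Longrightarrow> N b' \<subseteq> F \<and> vertex_weights b' (N b') (\<delta> b')"
    and "b \<in> F"
  shows "belief_value M Bad b
    \<le> max_reach_prob (disc_belief_mdp M F N \<delta>) b (bad_beliefs M Bad \<inter> F)"
proof -
  interpret wf_pomdp M
    by fact
  interpret disc_pomdp M F N \<delta>
    using assms(3,5) by unfold_locales auto
  show ?thesis
    using assms(2,6) by (rule belief_value_le)
qed

end
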